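(* Let $n$ be even. For each $k\in\{1,\dots,n/2-1\}$ the operator $Q_k:\mathcal E^k\to\mathcal E_k$ cannot be written in the form $L+\delta U$, where $L:\mathcal E^k\to\mathcal E_k$ is a natural differential operator with $L|_{\mathcal C^k}$ conformally invariant, and $U$ is a natural differential operator $\mathcal E^k\to\mathcal E_{k+1}$.
   Context: Setting and notation. $M$ is a smooth manifold of even dimension $n$ with a (pseudo-Riemannian) conformal structure $[g]$. $\mathcal E[w]$ is the bundle of conformal densities of weight $w$, normalised so that $(-n)$-densities are integrable; a choice of $g\in[g]$ trivialises all $\mathcal E[w]$. $\boldsymbol g\in S^2T^*M\otimes\mathcal E[2]$ is the conformal metric. $\mathcal E^k$ denotes (sections of) the bundle of $k$-forms, $\mathcal E_k=\mathcal E^k\otimes\mathcal E[2k-n]$, and $\mathcal C^k\subset\mathcal E^k$ is the space of closed $k$-forms. Let $\varphi\cdot\psi$ be the pointwise form inner product determined by $\boldsymbol g^{-1}$; for $\varphi\in\mathcal E^k$, $\psi\in\mathcal E_k$ it is a $(-n)$-density, and $\langle\varphi,\psi\rangle=\int\varphi\cdot\psi$. $\delta:\mathcal E_{k+1}\to\mathcal E_k$ is the formal adjoint of the exterior derivative $d:\mathcal E^k\to\mathcal E^{k+1}$ for this pairing; it is conformally invariant. In a scale $g$, $\delta$ also denotes the usual coderivative. A natural differential operator is one given by a universal polynomial formula in the metric, its inverse, the Levi-Civita connection $\nabla$ and the Riemann curvature $R$. $L|_{\mathcal C^k}$ is conformally invariant if $L^{\hat g}u=L^gu$ for all $u\in\mathcal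 C^k$ and all $\hat g=e^{2\omega}g$. The operators $Q_k$. $Q_k=Q_k^g:\mathcal E^k\to\mathcal E_k$ ($k=0,1,\dots,n/2+1$) is the family of natural differential operators constructed by Branson and Gover, with the following known properties. (1) Each $Q_k^g$ is formally self-adjoint; $Q_{n/2}$ is a nonzero constant and $Q_{n/2+1}=0$. (2) For $k\le n/2$, up to a nonzero constant scale, $Q_k^g$ has the form $(d\delta)^{n/2-k}+$ lower order terms. (3) $Q_01$ is, up to such a scale, the Branson $Q$-curvature. (4) On closed $k$-forms $u$, for $\hat g=e^{2\omega}g$, $Q_k^{\hat g}u=Q_k^gu+\delta Q_{k+1}^g d(\omega u)$. (5) $L_k:=\delta Q_{k+1}^gd:\mathcal E^k\to\mathcal E_k$ is conformally invariant. *)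

theory Defs
  imports "HOL-Analysis.Analysis" "HOL-Combinatorics.Permutations"
begin

section \<open>Calculus on coordinate space\<close>

definition pd :: "'n::finite \<Rightarrow> (real^'n \<Rightarrow> real) \<Rightarrow> real^'n \<Rightarrow> real" where
  "pd i f x = frechet_derivative f (at x) (axis i 1)"

definition smooth_on :: "(real^'n::finite) set \<Rightarrow> (real^'n \<Rightarrow> real) \<Rightarrow> bool" where
  "smooth_on S f \<longleftrightarrow> (\<forall>is. \<forall>x\<in>S. foldr pd is f differentiable (at x))"


section \<open>Smooth manifolds\<close>

type_synonym ('m, 'n) chart = "'m set \<times> ('m \<Rightarrow> real^'n)"

abbreviation coords :: "('m, 'n::finite) chart \<Rightarrow> (real^'n) set" where
  "coords c \<equiv> snd c ` fst c"

definition transition :: "('m, 'n::finite) chart \<Rightarrow> ('m, 'n) chart \<Rightarrow> real^'n \<Rightarrow> real^'n" where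
  "transition c c' x = snd c' (inv_into (fst c) (snd c) x)"

definition overlap :: "('m, 'n::finite) chart \<Rightarrow> ('m, 'n) chart \<Rightarrow> (real^'n) set" where
  "overlap c c' = snd c ` (fst c \<inter> fst c')"

definition jacobian :: "('m, 'n::finite) chart \<Rightarrow> ('m, 'n) chart \<Rightarrow> real^'n \<Rightarrow> 'n \<Rightarrow> 'n \<Rightarrow> real" where
  "jacobian c c' x j i = pd i (\<lambda>y. transition c c' y $ j) x"

record ('m, 'n) manifold =
  top_of :: "'m topology"
  atlas :: "('m, 'n) chart set"

definition smooth_manifold :: "('m, 'n::finite) manifold \<Rightarrow> bool" where
  "smooth_manifold M \<longleftrightarrow>
     Hausdorff_space (top_of M) \<and> second_countable (top_of M) \<and>
     (\<Union>c\<in>atlas M. fst c) = topspace (top_of M) \<and>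
     (\<forall>c\<in>atlas M. openin (top_of M) (fst c) \<and> open (coords c) \<and>
        homeomorphic_map (subtopology (top_of M) (fst c)) (top_of_set (coords c)) (snd c)) \<and>
     (\<forall>c\<in>atlas M. \<forall>c'\<in>atlas M. \<forall>j. smooth_on (overlap c c') (\<lambda>x. transition c c' x $ j))"

text \<open>A second countable manifold of positive dimension has the cardinality of the continuum
  (or is empty), so up to diffeomorphism its points may be taken in \<^typ>\<open>real^'n\<close>; its topology
  is unrelated to that of \<^typ>\<open>real^'n\<close>.  Fixing this type lets one formula range over
  all manifolds of dimension \<open>CARD('n)\<close>.\<close>

type_synonym 'n mfd = "(real^'n, 'n) manifold"


section \<open>Tensor fields, metrics and forms\<close>

text \<open>All tensors are covariant.  A tensor of rank \<open>r\<close> is given by its components, indexed by lists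
  of length \<open>r\<close>; values on lists of other lengths are irrelevant.  A field on a coordinate domain
  assigns a tensor to the coordinates \<open>x\<close> of a point; a field on a manifold is a family of such
  coordinate representations, one for each chart.\<close>

type_synonym 'n tensor = "'n list \<Rightarrow> real"
type_synonym 'n lfield = "real^'n \<Rightarrow> 'n tensor"
type_synonym 'n field = "(real^'n, 'n) chart \<Rightarrow> 'n lfield"

definition alternating :: "nat \<Rightarrow> 'n tensor \<Rightarrow> bool" where
  "alternating k t \<longleftrightarrow> (\<forall>is \<sigma>. length is = k \<and> \<sigma> permutes {..<k} \<longrightarrow>
     t (permute_list \<sigma> is) = of_int (sign \<sigma>) * t is)"

definition tensor_field :: "nat \<Rightarrow> 'n::finite mfd \<Rightarrow> 'n field \<Rightarrow> bool" where
  "tensor_field r M T \<longleftrightarrow>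
     (\<forall>c\<in>atlas M. \<forall>is. length is = r \<longrightarrow> smooth_on (coords c) (\<lambda>x. T c x is)) \<and>
     (\<forall>c\<in>atlas M. \<forall>c'\<in>atlas M. \<forall>x\<in>overlap c c'. \<forall>is. length is = r \<longrightarrow>
        T c x is = (\<Sum>js | length js = r.
          (\<Prod>m<r. jacobian c c' x (js ! m) (is ! m)) * T c' (transition c c' x) js))"

definition is_form :: "nat \<Rightarrow> 'n::finite mfd \<Rightarrow> 'n field \<Rightarrow> bool" where
  "is_form k M u \<longleftrightarrow> tensor_field k M u \<and> (\<forall>c\<in>atlas M. \<forall>x\<in>coords c. alternating k (u c x))"

definition gmat :: "'n::finite lfield \<Rightarrow> real^'n \<Rightarrow> real^'n^'n" where
  "gmat g x = (\<chi> i j. g x [i, j])"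

definition ginv :: "'n::finite lfield \<Rightarrow> real^'n \<Rightarrow> 'n \<Rightarrow> 'n \<Rightarrow> real" where
  "ginv g x i j = matrix_inv (gmat g x) $ i $ j"

definition has_signature :: "nat \<Rightarrow> real^'n::finite^'n \<Rightarrow> bool" where
  "has_signature q A \<longleftrightarrow> (\<exists>P. \<exists>S :: 'n set. invertible P \<and> card S = q \<and>
     transpose P ** A ** P = (\<chi> i j. if i = j then (if i \<in> S then -1 else 1) else 0))"

text \<open>Pseudo-Riemannian metrics with \<open>q\<close> negative directions; symmetry is implied by the
  normal form in \<^const>\<open>has_signature\<close>.\<close>

definition is_metric :: "nat \<Rightarrow> 'n::finite mfd \<Rightarrow> 'n field \<Rightarrow> bool" where
  "is_metric q M g \<longleftrightarrow> tensor_field 2 M g \<and>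
     (\<forall>c\<in>atlas M. \<forall>x\<in>coords c. has_signature q (gmat (g c) x))"

text \<open>Smooth functions are forms of degree 0.\<close>

definition fmult :: "'n field \<Rightarrow> 'n field \<Rightarrow> 'n field" where
  "fmult f T = (\<lambda>c x is. f c x [] * T c x is)"

definition rescale :: "'n field \<Rightarrow> 'n field \<Rightarrow> 'n field" where
  "rescale \<omega> g = (\<lambda>c x is. exp (2 * \<omega> c x []) * g c x is)"


section \<open>Tensor calculus in coordinates\<close>

definition christoffel :: "'n::finite lfield \<Rightarrow> real^'n \<Rightarrow> 'n \<Rightarrow> 'n \<Rightarrow> 'n \<Rightarrow> real" where
  "christoffel g x b a c = (\<Sum>d\<in>UNIV. ginv g x b d *
     (pd a (\<lambda>y. g y [d, c]) x + pd c (\<lambda>y. g y [a, d]) x - pd d (\<lambda>y. g y [a, c]) x)) / 2"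

text \<open>The new index of \<open>\<nabla>T\<close> comes first.\<close>

definition nabla :: "'n::finite lfield \<Rightarrow> 'n lfield \<Rightarrow> 'n lfield" where
  "nabla g T x is = pd (hd is) (\<lambda>y. T y (tl is)) x -
     (\<Sum>j<length (tl is). \<Sum>b\<in>UNIV. christoffel g x b (hd is) (tl is ! j) * T x ((tl is)[j := b]))"

definition riemann :: "'n::finite lfield \<Rightarrow> 'n lfield" where
  "riemann g x is = (let i = is ! 0; j = is ! 1; k = is ! 2; l = is ! 3 in
     \<Sum>m\<in>UNIV. g x [l, m] *
       (pd i (\<lambda>y. christoffel g y m j k) x - pd j (\<lambda>y. christoffel g y m i k) x +
        (\<Sum>p\<in>UNIV. christoffel g x m i p * christoffel g x p j k -
                     christoffel g x m j p * christoffel g x p i k)))"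

definition tprod :: "nat \<Rightarrow> 'n lfield \<Rightarrow> 'n lfield \<Rightarrow> 'n lfield" where
  "tprod r S T x is = S x (take r is) * T x (drop r is)"

definition contract :: "'n::finite lfield \<Rightarrow> 'n lfield \<Rightarrow> 'n lfield" where
  "contract g T x is = (\<Sum>a\<in>UNIV. \<Sum>b\<in>UNIV. ginv g x a b * T x (a # b # is))"

definition ext_d :: "'n::finite lfield \<Rightarrow> 'n lfield" where
  "ext_d u x is = (\<Sum>j<length is. (-1) ^ j *
     pd (is ! j) (\<lambda>y. u y (take j is @ drop (Suc j) is)) x)"

definition coderiv :: "'n::finite lfield \<Rightarrow> 'n lfield \<Rightarrow> 'n lfield" where
  "coderiv g u x is = - contract g (nabla g u) x is"

definition closed_form :: "nat \<Rightarrow> 'n::finite mfd \<Rightarrow> 'n field \<Rightarrow> bool" where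
  "closed_form k M u \<longleftrightarrow> is_form k M u \<and>
     (\<forall>c\<in>atlas M. \<forall>x\<in>coords c. \<forall>is. length is = Suc k \<longrightarrow> ext_d (u c) x is = 0)"


section \<open>Conformal densities\<close>

text \<open>In a chart, the bundle \<open>E[-n]\<close> is identified with the bundle of integrable densities, hence
  \<open>E[w]\<close> with its power \<open>-w/n\<close>.  The scale \<open>g\<close> then corresponds to the section
  \<open>\<bar>det g\<bar> powr (- w / (2 * n))\<close> of \<open>E[w]\<close>, and the following map sends a field, regarded
  as a weighted field by means of the scale \<open>g\<close>, to the coordinate representation of that weighted
  field.  Weighted fields obtained from different scales can be compared directly.\<close>

definition dens :: "real \<Rightarrow> 'n::finite lfield \<Rightarrow> 'n lfield \<Rightarrow> 'n lfield" where
  "dens w g T x is = \<bar>det (gmat g x)\<bar> powr (- w / (2 * real CARD('n))) * T x is"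

text \<open>\<open>E^k\<close> is the bundle of \<open>k\<close>-forms and \<open>E_k\<close> its tensor product with \<open>E[2k - n]\<close>.  The
  formal adjoint \<open>E_(k+1) \<rightarrow> E_k\<close> of the exterior derivative is, in any scale \<open>g\<close>, the
  coderivative.\<close>

definition dens_E :: "nat \<Rightarrow> 'n::finite lfield \<Rightarrow> 'n lfield \<Rightarrow> 'n lfield" where
  "dens_E k = dens (2 * real k - real CARD('n))"

definition undens_E :: "nat \<Rightarrow> 'n::finite lfield \<Rightarrow> 'n lfield \<Rightarrow> 'n lfield" where
  "undens_E k = dens (- (2 * real k - real CARD('n)))"

definition codiff :: "nat \<Rightarrow> 'n::finite lfield \<Rightarrow> 'n lfield \<Rightarrow> 'n lfield" where
  "codiff k g \<psi> = dens_E k g (coderiv g (undens_E (Suc k) g \<psi>))"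

text \<open>The \<open>(-n)\<close>-density \<open>\<phi> \<cdot> \<psi>\<close> for \<open>\<phi>\<close> in \<open>E^k\<close> and \<open>\<psi>\<close> in \<open>E_k\<close>.  The power of \<open>det g\<close>
  arises because indices are raised with the inverse of the conformal metric
  \<open>\<bar>det g\<bar> powr (- 1 / n) * g\<close>.\<close>

definition form_pair :: "nat \<Rightarrow> 'n::finite lfield \<Rightarrow> 'n lfield \<Rightarrow> 'n lfield \<Rightarrow> real^'n \<Rightarrow> real" where
  "form_pair k g \<phi> \<psi> x = \<bar>det (gmat g x)\<bar> powr (real k / real CARD('n)) / fact k *
     (\<Sum>is | length is = k. \<Sum>js | length js = k.
        (\<Prod>m<k. ginv g x (is ! m) (js ! m)) * \<phi> x is * \<psi> x js)"


section \<open>Natural differential operators\<close>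

text \<open>The universal polynomial formulas in the metric \<open>g\<close>, its inverse, \<open>\<nabla>\<close>, the curvature and a
  \<open>k\<close>-form \<open>u\<close>.  In \<open>natural k e r F\<close> the formula \<open>F\<close> has rank \<open>r\<close> and is homogeneous of degree
  \<open>e\<close> in \<open>u\<close>.  The inverse metric enters through contractions; as all tensors are covariant, this
  accounts for all of its occurrences.\<close>

type_synonym 'n oper = "'n lfield \<Rightarrow> 'n lfield \<Rightarrow> 'n lfield"

inductive natural :: "nat \<Rightarrow> nat \<Rightarrow> nat \<Rightarrow> 'n::finite oper \<Rightarrow> bool" for k :: nat where
  const: "natural k 0 0 (\<lambda>g u x is. a)"
| metric: "natural k 0 2 (\<lambda>g u. g)"
| curvature: "natural k 0 4 (\<lambda>g u. riemann g)"
| argument: "natural k 1 k (\<lambda>g u. u)"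
| add: "natural k e r F \<Longrightarrow> natural k e r G \<Longrightarrow> natural k e r (\<lambda>g u x is. F g u x is + G g u x is)"
| prod: "natural k e r F \<Longrightarrow> natural k e' r' G \<Longrightarrow>
    natural k (e + e') (r + r') (\<lambda>g u. tprod r (F g u) (G g u))"
| perm: "natural k e r F \<Longrightarrow> \<sigma> permutes {..<r} \<Longrightarrow>
    natural k e r (\<lambda>g u x is. F g u x (permute_list \<sigma> is))"
| contr: "natural k e (Suc (Suc r)) F \<Longrightarrow> natural k e r (\<lambda>g u. contract g (F g u))"
| deriv: "natural k e r F \<Longrightarrow> natural k e (Suc r) (\<lambda>g u. nabla g (F g u))"

text \<open>Natural linear differential operators \<open>E^k \<rightarrow> E_l\<close> on manifolds with a metric of signature
  \<open>q\<close>.  The given formula is required to produce alternating tensors.\<close>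

definition natural_op :: "nat \<Rightarrow> nat \<Rightarrow> nat \<Rightarrow> 'n::finite oper \<Rightarrow> bool" where
  "natural_op q k l D \<longleftrightarrow> (\<exists>F. natural k 1 l F \<and>
     D = (\<lambda>g u. dens_E l g (F g u)) \<and>
     (\<forall>(M :: 'n mfd) g u. smooth_manifold M \<and> is_metric q M g \<and> is_form k M u \<longrightarrow>
        (\<forall>c\<in>atlas M. \<forall>x\<in>coords c. alternating l (F (g c) (u c) x))))"

definition apply_op :: "'n oper \<Rightarrow> 'n field \<Rightarrow> 'n field \<Rightarrow> 'n field" where
  "apply_op D g u = (\<lambda>c. D (g c) (u c))"

definition agree :: "nat \<Rightarrow> 'n::finite mfd \<Rightarrow> 'n field \<Rightarrow> 'n field \<Rightarrow> bool" where
  "agree l M S T \<longleftrightarrow>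
     (\<forall>c\<in>atlas M. \<forall>x\<in>coords c. \<forall>is. length is = l \<longrightarrow> S c x is = T c x is)"

definition op_eq :: "nat \<Rightarrow> nat \<Rightarrow> nat \<Rightarrow> 'n::finite oper \<Rightarrow> 'n oper \<Rightarrow> bool" where
  "op_eq q k l D D' \<longleftrightarrow> (\<forall>(M :: 'n mfd) g u.
     smooth_manifold M \<and> is_metric q M g \<and> is_form k M u \<longrightarrow>
     agree l M (apply_op D g u) (apply_op D' g u))"

definition conf_inv :: "nat \<Rightarrow> nat \<Rightarrow> nat \<Rightarrow> 'n::finite oper \<Rightarrow> bool" where
  "conf_inv q k l D \<longleftrightarrow> (\<forall>(M :: 'n mfd) g \<omega> u.
     smooth_manifold M \<and> is_metric q M g \<and> is_form 0 M \<omega> \<and> is_form k M u \<longrightarrow>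
     agree l M (apply_op D (rescale \<omega> g) u) (apply_op D g u))"

definition conf_inv_closed :: "nat \<Rightarrow> nat \<Rightarrow> nat \<Rightarrow> 'n::finite oper \<Rightarrow> bool" where
  "conf_inv_closed q k l D \<longleftrightarrow> (\<forall>(M :: 'n mfd) g \<omega> u.
     smooth_manifold M \<and> is_metric q M g \<and> is_form 0 M \<omega> \<and> closed_form k M u \<longrightarrow>
     agree l M (apply_op D (rescale \<omega> g) u) (apply_op D g u))"

text \<open>The differential order is less than \<open>m\<close>: at each point the value is determined by the
  partial derivatives of \<open>u\<close> of order less than \<open>m\<close> there.\<close>

definition order_less :: "nat \<Rightarrow> nat \<Rightarrow> nat \<Rightarrow> nat \<Rightarrow> 'n::finite oper \<Rightarrow> bool" where
  "order_less q k l m D \<longleftrightarrow> (\<forall>(M :: 'n mfd) g u.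
     smooth_manifold M \<and> is_metric q M g \<and> is_form k M u \<longrightarrow>
     (\<forall>c\<in>atlas M. \<forall>x\<in>coords c.
        (\<forall>as is. length as < m \<and> length is = k \<longrightarrow> foldr pd as (\<lambda>y. u c y is) x = 0) \<longrightarrow>
        (\<forall>is. length is = l \<longrightarrow> D (g c) (u c) x is = 0)))"

text \<open>Formal self-adjointness \<open>\<langle>\<phi>, D \<psi>\<rangle> = \<langle>D \<phi>, \<psi>\<rangle>\<close>, tested on forms with compact support in a
  chart; by partitions of unity this is the same as testing on all compactly supported forms.\<close>

definition self_adjoint :: "nat \<Rightarrow> nat \<Rightarrow> 'n::finite oper \<Rightarrow> bool" where
  "self_adjoint q k D \<longleftrightarrow> (\<forall>(M :: 'n mfd) g \<phi> \<psi>.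
     smooth_manifold M \<and> is_metric q M g \<and> is_form k M \<phi> \<and> is_form k M \<psi> \<longrightarrow>
     (\<forall>c\<in>atlas M. \<forall>K. compact K \<and> K \<subseteq> coords c \<and>
        (\<forall>x\<in>coords c - K. \<forall>is. length is = k \<longrightarrow> \<phi> c x is = 0 \<and> \<psi> c x is = 0) \<longrightarrow>
        (LINT x:coords c|lborel. form_pair k (g c) (\<phi> c) (D (g c) (\<psi> c)) x) =
        (LINT x:coords c|lborel. form_pair k (g c) (\<psi> c) (D (g c) (\<phi> c)) x)))"

end

theory Submission
  imports Defs
begin

text \<open>The argument takes place on coordinate space with a flat metric \<open>g\<close> and the conformal metrics
  \<open>e^(2ty) g\<close>, where \<open>y\<close> is a coordinate.  If \<open>Q\<^sub>k = L + \<delta>U\<close>, then for closed \<open>u\<close> the transformation law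
  of \<open>Q\<^sub>k\<close> says that \<open>\<delta>U u\<close> changes by exactly \<open>t \<delta>Q\<^sub>k\<^sub>+\<^sub>1 d(yu)\<close>.  On the other hand, \<open>y g\<close> is half the Lie
  derivative of \<open>g\<close> along a special conformal field \<open>X\<close>, so by naturality the change is
  \<open>t (L\<^sub>X \<delta>U u - \<delta>U L\<^sub>X u)\<close> up to \<open>O(t^2)\<close>, with \<open>U\<close> taken for \<open>g\<close>.
  For \<open>u = z^p dz \<and> dx\<^sub>2 \<and> \<dots> \<and> dx\<^sub>k\<close> this vanishes: \<open>U\<close> kills every form \<open>f dx\<^sub>1 \<and> \<dots> \<and> dx\<^sub>k\<close> in which \<open>f\<close>
  depends on \<open>x\<^sub>1, \<dots>, x\<^sub>k\<close> only, since a \<open>(k+1)\<close>-form has a component in another direction and reflection in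
  that direction reverses it; and \<open>L\<^sub>X u\<close> is a sum of Lie derivatives of such forms along rotations,
  with which \<open>U\<close> commutes.  Hence \<open>\<delta>Q\<^sub>k\<^sub>+\<^sub>1 d(yu) = 0\<close>.  But the leading term of \<open>Q\<^sub>k\<^sub>+\<^sub>1\<close> shows that this is a
  nonzero multiple of \<open>dy \<and> dx\<^sub>2 \<and> \<dots> \<and> dx\<^sub>k\<close> at the origin if \<open>p = n - 2k - 1\<close>.\<close>

subsection \<open>Partial derivatives\<close>

lemma pd_eqI:
  fixes f :: "real^'n::finite \<Rightarrow> real"
  assumes "(f has_derivative f') (at x)"
  shows "pd i f x = f' (axis i 1)"
  using frechet_derivative_at[OF assms] by (simp add: pd_def)

lemma pd_has_derivative:
  fixes f :: "real^'n::finite \<Rightarrow> real"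
  assumes "f differentiable at x"
  shows "(f has_derivative frechet_derivative f (at x)) (at x)"
  using assms frechet_derivative_works by blast

lemma pd_const [simp]: "pd i (\<lambda>x. a) = (\<lambda>x. 0)"
  by (rule ext) (simp add: pd_def)

lemma pd_add:
  fixes f g :: "real^'n::finite \<Rightarrow> real"
  assumes "\<And>x. f differentiable at x" "\<And>x. g differentiable at x"
  shows "pd i (\<lambda>x. f x + g x) = (\<lambda>x. pd i f x + pd i g x)"
  by (rule ext, subst pd_eqI[OF has_derivative_add[OF assms[THEN pd_has_derivative]]])
     (simp add: pd_def)

lemma pd_mult:
  fixes f g :: "real^'n::finite \<Rightarrow> real"
  assumes "\<And>x. f differentiable at x" "\<And>x. g differentiable at x"
  shows "pd i (\<lambda>x. f x * g x) = (\<lambda>x. pd i f x * g x + f x * pd i g x)"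
  by (rule ext, subst pd_eqI[OF has_derivative_mult[OF assms[THEN pd_has_derivative]]])
     (simp add: pd_def)

lemma pd_comp_coord:
  fixes \<phi> :: "real \<Rightarrow> real"
  assumes "\<And>s. (\<phi> has_real_derivative \<phi>' s) (at s)"
  shows "pd i (\<lambda>x::real^'n::finite. \<phi> (x $ j)) = (\<lambda>x. if i = j then \<phi>' (x $ j) else 0)"
    and "(\<lambda>x::real^'n::finite. \<phi> (x $ j)) differentiable at x"
proof -
  have "((\<lambda>x. \<phi> (x $ j)) has_derivative (\<lambda>h. \<phi>' (x $ j) * h $ j)) (at x)" for x :: "real^'n"
  proof -
    have "((\<lambda>x::real^'n. x $ j) has_derivative (\<lambda>h. h $ j)) (at x)"
      by (intro bounded_linear_imp_has_derivative bounded_linear_vec_nth)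
    from has_derivative_compose[OF this assms[unfolded has_field_derivative_def]]
    show ?thesis .
  qed
  note D = this
  show "pd i (\<lambda>x::real^'n. \<phi> (x $ j)) = (\<lambda>x. if i = j then \<phi>' (x $ j) else 0)"
    by (rule ext, subst pd_eqI[OF D]) (auto simp: axis_def)
  show "(\<lambda>x::real^'n. \<phi> (x $ j)) differentiable at x" using D differentiable_def by blast
qed

subsection \<open>Families of smooth functions with bounded derivatives\<close>

text \<open>The symmetry of the second derivatives is part of the definition, since it is evident for
  all functions that occur here.\<close>

definition tame0 :: "(real \<Rightarrow> real^'n::finite \<Rightarrow> real) \<Rightarrow> bool" where
  "tame0 C \<longleftrightarrow> (\<forall>t x. C t differentiable at x) \<and> (\<forall>t x a. pd a (C t) differentiable at x) \<and>
     (\<forall>t a b. pd a (pd b (C t)) = pd b (pd a (C t))) \<and>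
     (\<forall>x. \<exists>B. \<forall>t. \<bar>t\<bar> \<le> 1 \<longrightarrow> \<bar>C t x\<bar> \<le> B)"

text \<open>Counting orders of differentiation turns closure properties into inductions on
  \<open>m\<close>, while the limit \<open>tame\<close> over all \<open>m\<close> is stable under
  \<open>pd\<close>.\<close>

primrec tame_upto :: "nat \<Rightarrow> (real \<Rightarrow> real^'n::finite \<Rightarrow> real) \<Rightarrow> bool" where
  "tame_upto 0 C = tame0 C"
| "tame_upto (Suc m) C = (tame0 C \<and> (\<forall>a. tame_upto m (\<lambda>t. pd a (C t))))"

definition tame :: "(real \<Rightarrow> real^'n::finite \<Rightarrow> real) \<Rightarrow> bool" where
  "tame C \<longleftrightarrow> (\<forall>m. tame_upto m C)"

abbreviation tamef :: "(real^'n::finite \<Rightarrow> real) \<Rightarrow> bool" where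
  "tamef f \<equiv> tame (\<lambda>_. f)"

lemma tame_upto_0: "tame_upto m C \<Longrightarrow> tame0 C"
  by (cases m) auto

lemma tame_upto_Suc: "tame_upto (Suc m) C \<Longrightarrow> tame_upto m C"
  by (induction m arbitrary: C) auto

lemma tame_imp_tame0: "tame C \<Longrightarrow> tame0 C"
  using tame_def tame_upto_0 by blast

lemma tame_diff: "tame C \<Longrightarrow> C t differentiable at x"
  by (drule tame_imp_tame0) (simp add: tame0_def)

lemma tame_bounded: "tame C \<Longrightarrow> \<exists>B. \<forall>t. \<bar>t\<bar> \<le> 1 \<longrightarrow> \<bar>C t x\<bar> \<le> B"
  by (drule tame_imp_tame0) (simp add: tame0_def)

lemma tame_comm: "tame C \<Longrightarrow> pd a (pd b (C t)) = pd b (pd a (C t))"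
  by (drule tame_imp_tame0) (simp add: tame0_def)

lemma tame_pd: "tame C \<Longrightarrow> tame (\<lambda>t. pd a (C t))"
  unfolding tame_def by (metis tame_upto.simps(2))

lemma tameI: "tame0 C \<Longrightarrow> (\<And>a. tame (\<lambda>t. pd a (C t))) \<Longrightarrow> tame C"
  unfolding tame_def
proof
  show "tame_upto m C" if "tame0 C" "\<And>a. \<forall>m. tame_upto m (\<lambda>t. pd a (C t))" for m
    using that by (cases m) auto
qed

lemma tameI':
  assumes "\<And>t x. C t differentiable at x" "\<And>x t. \<bar>t\<bar> \<le> 1 \<Longrightarrow> \<bar>C t x\<bar> \<le> B x"
    "\<And>t a b. pd a (pd b (C t)) = pd b (pd a (C t))" "\<And>a. tame (\<lambda>t. pd a (C t))"
  shows "tame C"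
proof (rule tameI)
  have "\<forall>t. \<bar>t\<bar> \<le> 1 \<longrightarrow> \<bar>C t x\<bar> \<le> B x" for x using assms(2) by blast
  with assms(1,3) tame_diff[OF assms(4)] show "tame0 C" unfolding tame0_def by blast
qed fact

lemma tame0_add:
  assumes "tame0 C" "tame0 D" shows "tame0 (\<lambda>t x. C t x + D t x)"
proof -
  have d: "\<And>t x. C t differentiable at x" "\<And>t x. D t differentiable at x"
    and d2: "\<And>t x a. pd a (C t) differentiable at x" "\<And>t x a. pd a (D t) differentiable at x"
    and c: "\<And>t a b. pd a (pd b (C t)) = pd b (pd a (C t))"
      "\<And>t a b. pd a (pd b (D t)) = pd b (pd a (D t))"
    using assms by (auto simp: tame0_def)
  have "\<exists>B. \<forall>t. \<bar>t\<bar> \<le> 1 \<longrightarrow> \<bar>C t x + D t x\<bar> \<le> B" for x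
  proof -
    obtain B where "\<And>t. \<bar>t\<bar> \<le> 1 \<Longrightarrow> \<bar>C t x\<bar> \<le> B" using assms(1) by (meson tame0_def)
    moreover obtain B' where "\<And>t. \<bar>t\<bar> \<le> 1 \<Longrightarrow> \<bar>D t x\<bar> \<le> B'" using assms(2) by (meson tame0_def)
    ultimately have "\<forall>t. \<bar>t\<bar> \<le> 1 \<longrightarrow> \<bar>C t x + D t x\<bar> \<le> B + B'"
      by (smt (verit))
    then show ?thesis by blast
  qed
  moreover have "pd a (pd b (\<lambda>x. C t x + D t x)) = pd b (pd a (\<lambda>x. C t x + D t x))" for t a b
    using d d2 by (simp add: pd_add c(1)[of a b] c(2)[of a b])
  moreover have "(\<lambda>x. C t x + D t x) differentiable at x"
    "pd b (\<lambda>x. C t x + D t x) differentiable at x" for t b x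
    using d d2 by (simp_all add: pd_add)
  ultimately show ?thesis unfolding tame0_def by blast
qed

lemma tame0_mult:
  assumes "tame0 C" "tame0 D" shows "tame0 (\<lambda>t x. C t x * D t x)"
proof -
  have d: "\<And>t x. C t differentiable at x" "\<And>t x. D t differentiable at x"
    and d2: "\<And>t x a. pd a (C t) differentiable at x" "\<And>t x a. pd a (D t) differentiable at x"
    and c: "\<And>t a b. pd a (pd b (C t)) = pd b (pd a (C t))"
      "\<And>t a b. pd a (pd b (D t)) = pd b (pd a (D t))"
    using assms by (auto simp: tame0_def)
  have "\<exists>B. \<forall>t. \<bar>t\<bar> \<le> 1 \<longrightarrow> \<bar>C t x * D t x\<bar> \<le> B" for x
  proof -
    obtain B where "\<And>t. \<bar>t\<bar> \<le> 1 \<Longrightarrow> \<bar>C t x\<bar> \<le> B" using assms(1) by (meson tame0_def)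
    moreover obtain B' where "\<And>t. \<bar>t\<bar> \<le> 1 \<Longrightarrow> \<bar>D t x\<bar> \<le> B'" using assms(2) by (meson tame0_def)
    ultimately have "\<forall>t. \<bar>t\<bar> \<le> 1 \<longrightarrow> \<bar>C t x * D t x\<bar> \<le> B * B'"
      by (auto simp: abs_mult intro!: mult_mono) (smt (verit))
    then show ?thesis by blast
  qed
  moreover have "pd a (pd b (\<lambda>x. C t x * D t x)) = pd b (pd a (\<lambda>x. C t x * D t x))" for t a b
    using d d2 by (simp add: pd_add pd_mult c(1)[of a b] c(2)[of a b] algebra_simps)
  moreover have "pd b (\<lambda>x. C t x * D t x) differentiable at x" for t b x
    using d d2 by (simp add: pd_mult)
  ultimately show ?thesis unfolding tame0_def
    using d by simp
qed

lemma tame_upto_add: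
  "tame_upto m C \<Longrightarrow> tame_upto m D \<Longrightarrow> tame_upto m (\<lambda>t x. C t x + D t x)"
proof (induction m arbitrary: C D)
  case (Suc m)
  then have "pd a (\<lambda>x. C t x + D t x) = (\<lambda>x. pd a (C t) x + pd a (D t) x)" for a t
    by (intro pd_add) (auto simp: tame0_def)
  with Suc show ?case by (auto simp: tame0_add)
qed (simp add: tame0_add)

lemma tame_upto_mult:
  "tame_upto m C \<Longrightarrow> tame_upto m D \<Longrightarrow> tame_upto m (\<lambda>t x. C t x * D t x)"
proof (induction m arbitrary: C D)
  case (Suc m)
  then have "pd a (\<lambda>x. C t x * D t x) = (\<lambda>x. pd a (C t) x * D t x + C t x * pd a (D t) x)" for a t
    by (intro pd_mult) (auto simp: tame0_def)
  moreover have "tame_upto m (\<lambda>t x. pd a (C t) x * D t x + C t x * pd a (D t) x)" for a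
    using Suc.prems tame_upto_Suc[OF Suc.prems(1)] tame_upto_Suc[OF Suc.prems(2)]
    by (intro tame_upto_add Suc.IH) auto
  ultimately show ?case using Suc.prems by (simp add: tame0_mult)
qed (simp add: tame0_mult)

lemma tame_add: "tame C \<Longrightarrow> tame D \<Longrightarrow> tame (\<lambda>t x. C t x + D t x)"
  by (simp add: tame_def tame_upto_add)

lemma tame_mult: "tame C \<Longrightarrow> tame D \<Longrightarrow> tame (\<lambda>t x. C t x * D t x)"
  by (simp add: tame_def tame_upto_mult)

text \<open>Tameness constrains the dependence on t only through a bound on [-1, 1], so a bounded
  coefficient qualifies; its x-derivatives vanish.\<close>

lemma tame_scalar:
  assumes "\<And>t. \<bar>t\<bar> \<le> 1 \<Longrightarrow> \<bar>s t\<bar> \<le> B"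
  shows "tame (\<lambda>t x. s t)"
proof -
  have "tame0 (\<lambda>t x::real^'a. r t)" if "\<And>t. \<bar>t\<bar> \<le> 1 \<Longrightarrow> \<bar>r t\<bar> \<le> B" for r B
    unfolding tame0_def using that by (auto intro!: exI[of _ B])
  from this[of s, OF assms] this[of "\<lambda>_. 0" 0]
  have "tame0 (\<lambda>t x::real^'a. s t)" "tame0 (\<lambda>t x::real^'a. 0)"
    by simp_all
  have "tame_upto m (\<lambda>t x::real^'a. 0)" for m
    by (induction m) (simp_all add: \<open>tame0 (\<lambda>t x. 0)\<close>)
  then have "tame (\<lambda>t x::real^'a. 0)" unfolding tame_def by blast
  show ?thesis by (rule tameI) (simp_all add: \<open>tame (\<lambda>t x. 0)\<close> \<open>tame0 (\<lambda>t x. s t)\<close>)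
qed

lemma tame_const [simp]: "tame (\<lambda>t x. a)"
  by (rule tame_scalar[of _ "\<bar>a\<bar>"]) auto

lemma tame_t [simp]: "tame (\<lambda>t x. t)"
  by (rule tame_scalar[of _ 1]) auto

lemma pd_coord: "pd i (\<lambda>x. x $ j) = (\<lambda>x. if i = j then 1 else 0)"
  by (rule pd_comp_coord) (rule DERIV_ident)

lemma tame_coord [simp]: "tame (\<lambda>t x. x $ j)"
proof (rule tameI)
  have "(\<lambda>x::real^'a. x $ j) differentiable at x" for x
    by (rule pd_comp_coord) (rule DERIV_ident)
  then show "tame0 (\<lambda>t x::real^'a. x $ j)" by (auto simp: tame0_def pd_coord)
  show "tame (\<lambda>t. pd a (\<lambda>x::real^'a. x $ j))" for a by (simp add: pd_coord)
qed

lemma tame_uminus: "tame C \<Longrightarrow> tame (\<lambda>t x. - C t x)"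
  using tame_mult[OF tame_const[of "-1"], of C] by simp

lemma tame_diff2: "tame C \<Longrightarrow> tame D \<Longrightarrow> tame (\<lambda>t x. C t x - D t x)"
  using tame_add[OF _ tame_uminus] by fastforce

lemma tame_cdiv: "tame C \<Longrightarrow> tame (\<lambda>t x. C t x / a)"
  using tame_mult[OF tame_const[of "inverse a"], of C] by (simp add: field_simps)

lemma tame_sum: "(\<And>i. i \<in> I \<Longrightarrow> tame (C i)) \<Longrightarrow> tame (\<lambda>t x. \<Sum>i\<in>I. C i t x)"
  by (induction I rule: infinite_finite_induct) (auto intro: tame_add)

lemma tame_power: "tame C \<Longrightarrow> tame (\<lambda>t x. C t x ^ p)"
  by (induction p) (auto intro: tame_mult)

lemma tame_const_fam: "tame C \<Longrightarrow> tamef (C t)"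
proof -
  have tame0: "tame0 (\<lambda>_. D t)" if "tame0 D" for D :: "real \<Rightarrow> real^'a \<Rightarrow> real"
    using that by (auto simp: tame0_def)
  have "tame_upto m C \<Longrightarrow> tame_upto m (\<lambda>_. C t)" for m
  proof (induction m arbitrary: C)
    case (Suc m)
    have "tame_upto m (\<lambda>_. pd a (C t))" for a
      using Suc.IH[of "\<lambda>t. pd a (C t)"] Suc.prems by simp
    then show ?case using tame0 Suc.prems by simp
  qed (simp add: tame0)
  then show "tame C \<Longrightarrow> tamef (C t)" by (simp add: tame_def)
qed

lemmas tame_intros = tame_add tame_mult tame_uminus tame_diff2 tame_cdiv tame_sum tame_power tame_pd

lemma pd_sum:
  assumes "\<And>i. i \<in> I \<Longrightarrow> tamef (f i)"
  shows "pd a (\<lambda>x. \<Sum>i\<in>I. f i x) = (\<lambda>x. \<Sum>i\<in>I. pd a (f i) x)"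
  using assms
proof (induction I rule: infinite_finite_induct)
  case (insert i I)
  then have "pd a (\<lambda>x. f i x + (\<Sum>i\<in>I. f i x)) = (\<lambda>x. pd a (f i) x + pd a (\<lambda>x. \<Sum>i\<in>I. f i x) x)"
    by (intro pd_add tame_diff[of "\<lambda>_. f i"] tame_diff[of "\<lambda>_ x. \<Sum>i\<in>I. f i x"] tame_sum) auto
  with insert show ?case by simp
qed auto

lemma pd_add': "tamef f \<Longrightarrow> tamef g \<Longrightarrow> pd i (\<lambda>x. f x + g x) = (\<lambda>x. pd i f x + pd i g x)"
  using tame_diff by (intro pd_add) fastforce+

lemma pd_mult': "tamef f \<Longrightarrow> tamef g \<Longrightarrow> pd i (\<lambda>x. f x * g x) = (\<lambda>x. pd i f x * g x + f x * pd i g x)"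
  using tame_diff by (intro pd_mult) fastforce+

lemma pd_cmult: "tamef f \<Longrightarrow> pd i (\<lambda>x. a * f x) = (\<lambda>x. a * pd i f x)"
  by (simp add: pd_mult')

lemma pd_uminus: "tamef f \<Longrightarrow> pd i (\<lambda>x. - f x) = (\<lambda>x. - pd i f x)"
  using pd_cmult[of f i "-1"] by simp

lemma pd_diff: "tamef f \<Longrightarrow> tamef g \<Longrightarrow> pd i (\<lambda>x. f x - g x) = (\<lambda>x. pd i f x - pd i g x)"
  using pd_add'[of f "\<lambda>x. - g x"] by (simp add: tame_intros pd_uminus)

lemma pd_cmult_right: "tamef f \<Longrightarrow> pd i (\<lambda>x. f x * a) = (\<lambda>x. pd i f x * a)"
  by (simp add: pd_mult')

lemma tamef_smooth_on: "tamef f \<Longrightarrow> smooth_on S f"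
proof -
  assume f: "tamef f"
  have "tamef (foldr pd is f)" for "is"
    by (induction "is") (auto intro: f tame_pd[of "\<lambda>_. _"])
  then show ?thesis using tame_diff by (fastforce simp: smooth_on_def)
qed

text \<open>Differentiation multiplies \<open>s t\<close> by \<open>t * c\<close> or by 0. The
  prefactor thus makes the family closed under \<open>pd\<close>, and it stays bounded for |t| at
  most 1.\<close>

lemma tame_scaled_exp:
  assumes "\<And>t. \<bar>t\<bar> \<le> 1 \<Longrightarrow> \<bar>s t\<bar> \<le> B"
  shows "tame (\<lambda>t x. s t * exp (t * c * x $ y))"
proof -
  have D: "pd a (\<lambda>x::real^'a. s * exp (r * x $ y)) = (\<lambda>x. (s * (if a = y then r else 0)) * exp (r * x $ y))"
    "(\<lambda>x::real^'a. s * exp (r * x $ y)) differentiable at x" for a s r x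
  proof -
    have *: "((\<lambda>z. s * exp (r * z)) has_real_derivative s * r * exp (r * z)) (at z)" for z
      by (auto intro!: derivative_eq_intros)
    show "pd a (\<lambda>x::real^'a. s * exp (r * x $ y)) = (\<lambda>x. (s * (if a = y then r else 0)) * exp (r * x $ y))"
      by (subst pd_comp_coord(1)[OF *]) auto
    show "(\<lambda>x::real^'a. s * exp (r * x $ y)) differentiable at x"
      by (rule pd_comp_coord(2)[OF *])
  qed
  have t0: "tame0 (\<lambda>t x::real^'a. s t * exp (t * c * x $ y))"
    if "\<And>t. \<bar>t\<bar> \<le> 1 \<Longrightarrow> \<bar>s t\<bar> \<le> B" for s B
  proof -
    have "\<bar>s t * exp (t * c * x $ y)\<bar> \<le> B * exp \<bar>c * x $ y\<bar>" if t: "\<bar>t\<bar> \<le> 1" for t and x :: "real^'a"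
    proof -
      have "t * (c * x $ y) \<le> \<bar>t\<bar> * \<bar>c * x $ y\<bar>" by (simp flip: abs_mult)
      also have "\<dots> \<le> \<bar>c * x $ y\<bar>" using t mult_right_mono[of "\<bar>t\<bar>" 1] by force
      finally show ?thesis using \<open>\<bar>t\<bar> \<le> 1 \<Longrightarrow> \<bar>s t\<bar> \<le> B\<close>[OF t]
        by (auto simp: abs_mult mult.assoc intro!: mult_mono)
    qed
    then have "\<forall>x::real^'a. \<exists>B. \<forall>t. \<bar>t\<bar> \<le> 1 \<longrightarrow> \<bar>s t * exp (t * c * x $ y)\<bar> \<le> B" by blast
    then show ?thesis unfolding tame0_def D(1) by (intro conjI allI D(2)) (auto simp: algebra_simps)
  qed
  have "(\<forall>t. \<bar>t\<bar> \<le> 1 \<longrightarrow> \<bar>s t\<bar> \<le> B) \<Longrightarrow> tame_upto m (\<lambda>t x::real^'a. s t * exp (t * c * x $ y))" for m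
  proof (induction m arbitrary: s B)
    case 0
    then have "tame0 (\<lambda>t x::real^'a. s t * exp (t * c * x $ y))" by (intro t0[of s B]) auto
    then show ?case by simp
  next
    case (Suc m)
    have "tame_upto m (\<lambda>t. pd a (\<lambda>x::real^'a. s t * exp (t * c * x $ y)))" for a
      unfolding D
    proof (rule Suc.IH[where B="B * \<bar>c\<bar>"], intro allI impI)
      fix t :: real assume t: "\<bar>t\<bar> \<le> 1"
      with Suc.prems have "0 \<le> B" "\<bar>s t\<bar> \<le> B" by force+
      then show "\<bar>s t * (if a = y then t * c else 0)\<bar> \<le> B * \<bar>c\<bar>" using t
        by (auto simp: abs_mult intro!: mult_mono order_trans[OF mult_right_mono[of "\<bar>t\<bar>" 1]])
    qed
    moreover have "tame0 (\<lambda>t x::real^'a. s t * exp (t * c * x $ y))"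
      using Suc.prems by (intro t0[of s B]) auto
    ultimately show ?case by simp
  qed
  with assms show ?thesis unfolding tame_def by blast
qed

section \<open>Taylor bounds for the exponential, uniform in t\<close>

lemma abs_exp_minus_one_le: "\<bar>exp s - 1\<bar> \<le> \<bar>s\<bar> * exp \<bar>s\<bar>" for s :: real
proof (cases "s \<ge> 0")
  case True
  have "1 - s \<le> exp (- s)" using exp_ge_add_one_self[of "-s"] by simp
  then have "(1 - s) * exp s \<le> exp (- s) * exp s" by (intro mult_right_mono) auto
  then show ?thesis using True by (simp add: algebra_simps flip: exp_add)
next
  case False
  have "1 + s \<le> exp s" "exp s \<le> 1" using exp_ge_add_one_self[of s] False by auto
  with False have "\<bar>exp s - 1\<bar> \<le> \<bar>s\<bar> * 1" by linarith
  also have "\<dots> \<le> \<bar>s\<bar> * exp \<bar>s\<bar>" by (intro mult_left_mono) auto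
  finally show ?thesis .
qed

lemma abs_exp_minus_linear_le: "\<bar>exp s - 1 - s\<bar> \<le> s\<^sup>2 * exp \<bar>s\<bar>" for s :: real
proof -
  have a: "exp s - 1 - s \<ge> 0" using exp_ge_add_one_self[of s] by linarith
  have "1 - s \<le> exp (- s)" using exp_ge_add_one_self[of "-s"] by simp
  then have "(1 - s) * exp s \<le> exp (- s) * exp s" by (intro mult_right_mono) auto
  then have "exp s - 1 - s \<le> s * (exp s - 1)" by (simp add: algebra_simps flip: exp_add)
  also have "\<dots> \<le> \<bar>s\<bar> * \<bar>exp s - 1\<bar>" by (simp flip: abs_mult)
  also have "\<dots> \<le> \<bar>s\<bar> * (\<bar>s\<bar> * exp \<bar>s\<bar>)" by (intro mult_left_mono abs_exp_minus_one_le) auto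
  finally show ?thesis using a by (simp add: power2_eq_square mult.assoc[symmetric] flip: abs_mult)
qed

lemma abs_scaled_le: "\<bar>t\<bar> \<le> 1 \<Longrightarrow> \<bar>t * (z::real)\<bar> \<le> \<bar>z\<bar>"
  using mult_right_mono[of "\<bar>t\<bar>" 1 "\<bar>z\<bar>"] by (simp add: abs_mult)

text \<open>\<open>R\<close> is the second Taylor remainder divided by t^2. Differentiation in x
  takes it to a multiple of the first difference quotient \<open>S\<close>, and that to an
  exponential, so tameness reduces to \<open>tame_scaled_exp\<close> and pointwise bounds uniform in
  t.\<close>

lemma exp_expansion:
  obtains R where "tame R" "\<And>t x. exp (t * c * x $ y) = 1 + t * (c * x $ y) + t\<^sup>2 * R t (x::real^'n::finite)"
proof -
  \<comment> \<open>Division by 0 yields 0, so \<open>S 0\<close> and \<open>R 0\<close> vanish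
    identically; \<open>nz\<close> makes the formula for the derivative of \<open>S\<close> correct
    at t = 0 too. The value of \<open>R\<close> there is harmless because of the factor t^2.\<close>
  define nz where "nz t = (if t = 0 then 0 else 1 :: real)" for t :: real
  define S where "S t x = (exp (t * c * x $ y) - 1) / t" for t :: real and x :: "real^'n"
  define R where "R t x = (exp (t * c * x $ y) - 1 - t * c * x $ y) / t\<^sup>2" for t :: real and x :: "real^'n"
  have dS: "pd a (S t) = (\<lambda>x. (nz t * (if a = y then c else 0)) * exp (t * c * x $ y))"
       "S t differentiable at x" for a t x
  proof -
    have *: "((\<lambda>z. (exp (t * c * z) - 1) / t) has_real_derivative nz t * c * exp (t * c * z)) (at z)" for z
      by (cases "t = 0") (auto simp: nz_def intro!: derivative_eq_intros)
    show "pd a (S t) = (\<lambda>x. (nz t * (if a = y then c else 0)) * exp (t * c * x $ y))"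
      unfolding S_def by (subst pd_comp_coord(1)[OF *]) auto
    show "S t differentiable at x"
      unfolding S_def by (rule pd_comp_coord(2)[OF *])
  qed
  have dR: "pd a (R t) = (\<lambda>x. (if a = y then c else 0) * S t x)" "R t differentiable at x" for a t x
  proof -
    have *: "((\<lambda>z. (exp (t * c * z) - 1 - t * c * z) / t\<^sup>2) has_real_derivative
        c * ((exp (t * c * z) - 1) / t)) (at z)" for z
      by (cases "t = 0") (auto simp: power2_eq_square field_simps intro!: derivative_eq_intros)
    show "pd a (R t) = (\<lambda>x. (if a = y then c else 0) * S t x)"
      unfolding R_def S_def by (subst pd_comp_coord(1)[OF *]) auto
    show "R t differentiable at x"
      unfolding R_def by (rule pd_comp_coord(2)[OF *])
  qed
  have "tame (\<lambda>t. pd a (S t))" for a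
    unfolding dS by (rule tame_scaled_exp[where B="\<bar>c\<bar>"]) (auto simp: nz_def)
  note tS = this
  have B:  "\<bar>S t x\<bar> \<le> \<bar>c * x $ y\<bar> * exp \<bar>c * x $ y\<bar>" if "\<bar>t\<bar> \<le> 1" for t x
  proof (cases "t = 0")
    case False
    define z where "z = c * x $ y"
    have "\<bar>exp (t * z) - 1\<bar> \<le> \<bar>t * z\<bar> * exp \<bar>t * z\<bar>" by (rule abs_exp_minus_one_le)
    also have "\<dots> \<le> \<bar>t * z\<bar> * exp \<bar>z\<bar>" using abs_scaled_le[OF that, of z] by (intro mult_left_mono) auto
    finally have "\<bar>exp (t * z) - 1\<bar> \<le> \<bar>t\<bar> * (\<bar>z\<bar> * exp \<bar>z\<bar>)" by (simp add: abs_mult mult.assoc)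
    then show ?thesis using False by (simp add: S_def z_def field_simps)
  qed (simp add: S_def)
  have "pd a (\<lambda>x. r * exp (t * c * x $ y)) = (\<lambda>x::real^'n. if a = y then r * (t*c) * exp (t * c * x $ y) else 0)" for a t r
    by (subst pd_comp_coord(1)[where \<phi> = "\<lambda>z. r * exp (t * c * z)" and \<phi>' = "\<lambda>z. r * (t*c) * exp (t * c * z)"])
       (auto intro!: derivative_eq_intros)
  then have "pd a (pd b (S t)) = pd b (pd a (S t))" for a b t
    unfolding dS by auto
  note comm = this
  have S: "tame S" by (rule tameI'[OF dS(2) B comm tS])
  have tR: "tame (\<lambda>t. pd a (R t))" for a
    unfolding dR using S by (intro tame_intros) auto
  have B':  "\<bar>R t x\<bar> \<le> (c * x $ y)\<^sup>2 * exp \<bar>c * x $ y\<bar>" if "\<bar>t\<bar> \<le> 1" for t x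
  proof (cases "t = 0")
    case False
    define z where "z = c * x $ y"
    have "\<bar>exp (t * z) - 1 - t * z\<bar> \<le> (t * z)\<^sup>2 * exp \<bar>t * z\<bar>" by (rule abs_exp_minus_linear_le)
    also have "\<dots> \<le> (t * z)\<^sup>2 * exp \<bar>z\<bar>" using abs_scaled_le[OF that, of z] by (intro mult_left_mono) auto
    finally have "\<bar>exp (t * z) - 1 - t * z\<bar> \<le> t\<^sup>2 * (z\<^sup>2 * exp \<bar>z\<bar>)" by (simp add: power_mult_distrib mult.assoc)
    then show ?thesis using False by (simp add: R_def z_def field_simps)
  qed (simp add: R_def)
  have C:  "pd a (pd b (R t)) = pd b (pd a (R t))" for a b t
  proof -
    have "pd a (\<lambda>x. r * S t x) = (\<lambda>x. r * pd a (S t) x)" for a r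
      using pd_cmult[OF tame_const_fam[OF S]] .
    then show ?thesis unfolding dR unfolding dS by auto
  qed
  have "tame R" by (rule tameI'[OF dR(2) B' C tR])
  moreover have "exp (t * c * x $ y) = 1 + t * (c * x $ y) + t\<^sup>2 * R t x" for t x
    by (simp add: R_def)
  ultimately show thesis using that by blast
qed

subsection \<open>First order expansions\<close>

text \<open>A Taylor expansion in t whose tame remainder can be differentiated in x and stays
  bounded, pointwise in x, as t tends to 0.\<close>

definition expands :: "(real \<Rightarrow> real^'n::finite \<Rightarrow> real) \<Rightarrow> (real^'n \<Rightarrow> real) \<Rightarrow> (real^'n \<Rightarrow> real) \<Rightarrow> bool" where
  "expands T A B \<longleftrightarrow> tamef A \<and> tamef B \<and>
     (\<exists>C. tame C \<and> (\<forall>t x. T t x = A x + t * B x + t\<^sup>2 * C t x))"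

lemma expandsI:
  assumes "tamef A" "tamef B" "tame C" "\<And>t x. T t x = A x + t * B x + t\<^sup>2 * C t x"
  shows "expands T A B"
  using assms unfolding expands_def by blast

lemma expandsE:
  assumes "expands T A B"
  obtains C where "tamef A" "tamef B" "tame C" "\<And>t x. T t x = A x + t * B x + t\<^sup>2 * C t x"
  using assms unfolding expands_def by blast

lemma expands_tamef: "expands T A B \<Longrightarrow> tamef A" "expands T A B \<Longrightarrow> tamef B"
  by (auto simp: expands_def)

lemma expands_const: "tamef A \<Longrightarrow> expands (\<lambda>t. A) A (\<lambda>x. 0)"
  by (rule expandsI[of _ _ "\<lambda>t x. 0"]) auto

lemma expands_add:
  assumes "expands T A B" "expands T' A' B'"
  shows "expands (\<lambda>t x. T t x + T' t x) (\<lambda>x. A x + A' x) (\<lambda>x. B x + B' x)"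
proof -
  from assms(1) obtain C where C: "tamef A" "tamef B" "tame C"
    "\<And>t x. T t x = A x + t * B x + t\<^sup>2 * C t x" by (rule expandsE) blast
  from assms(2) obtain C' where C': "tamef A'" "tamef B'" "tame C'"
    "\<And>t x. T' t x = A' x + t * B' x + t\<^sup>2 * C' t x" by (rule expandsE) blast
  show ?thesis
    by (rule expandsI[of _ _ "\<lambda>t x. C t x + C' t x"])
       (auto intro!: tame_intros simp: C C' algebra_simps)
qed

lemma expands_mult:
  assumes "expands T A B" "expands T' A' B'"
  shows "expands (\<lambda>t x. T t x * T' t x) (\<lambda>x. A x * A' x) (\<lambda>x. B x * A' x + A x * B' x)"
proof -
  from assms(1) obtain C where C: "tamef A" "tamef B" "tame C"
    "\<And>t x. T t x = A x + t * B x + t\<^sup>2 * C t x" by (rule expandsE) blast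
  from assms(2) obtain C' where C': "tamef A'" "tamef B'" "tame C'"
    "\<And>t x. T' t x = A' x + t * B' x + t\<^sup>2 * C' t x" by (rule expandsE) blast
  show ?thesis
    by (rule expandsI[of _ _ "\<lambda>t x. A x * C' t x + C t x * A' x + B x * B' x +
          t * (B x * C' t x + C t x * B' x) + t * t * (C t x * C' t x)"])
       (auto intro!: tame_intros simp: C C' algebra_simps power2_eq_square)
qed

lemma expands_cmult: "expands T A B \<Longrightarrow> expands (\<lambda>t x. a * T t x) (\<lambda>x. a * A x) (\<lambda>x. a * B x)"
  using expands_mult[OF expands_const[OF tame_const[of a]]] by simp

lemma expands_sum:
  assumes "\<And>i. i \<in> I \<Longrightarrow> expands (T i) (A i) (B i)"
  shows "expands (\<lambda>t x. \<Sum>i\<in>I. T i t x) (\<lambda>x. \<Sum>i\<in>I. A i x) (\<lambda>x. \<Sum>i\<in>I. B i x)"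
  using assms
  by (induction I rule: infinite_finite_induct) (auto intro: expands_add expands_const)

text \<open>A factor t promotes the zeroth order term to first order. The Christoffel part of
  \<open>nabla\<close> enters the variation in this way.\<close>

lemma expands_times_t:
  assumes "expands T A B" shows "expands (\<lambda>t x. t * T t x) (\<lambda>x. 0) A"
proof -
  from assms obtain C where C: "tamef A" "tamef B" "tame C"
    "\<And>t x. T t x = A x + t * B x + t\<^sup>2 * C t x" by (rule expandsE) blast
  show ?thesis
    by (rule expandsI[of _ _ "\<lambda>t x. B x + t * C t x"])
       (auto intro!: tame_intros simp: C algebra_simps power2_eq_square)
qed

lemma expands_pd:
  assumes "expands T A B"
  shows "expands (\<lambda>t. pd a (T t)) (pd a A) (pd a B)"
proof -
  from assms obtain C where C: "tamef A" "tamef B" "tame C"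
    "\<And>t x. T t x = A x + t * B x + t\<^sup>2 * C t x" by (rule expandsE) blast
  have "T t = (\<lambda>x. A x + (t * B x + t\<^sup>2 * C t x))" for t using C(4) by (auto simp: fun_eq_iff)
  then have "pd a (T t) = (\<lambda>x. pd a A x + (t * pd a B x + t\<^sup>2 * pd a (C t) x))" for t
    using C tame_const_fam[OF C(3)] by (simp add: pd_add' pd_cmult tame_intros)
  then show ?thesis using C
    by (intro expandsI[of _ _ "\<lambda>t x. pd a (C t) x"]) (auto intro: tame_pd)
qed

lemma expands_exp:
  "expands (\<lambda>t x. exp (t * c * x $ y)) (\<lambda>x. 1) (\<lambda>x. c * x $ y)"
proof -
  obtain R where "tame R" "\<And>t x. exp (t * c * x $ y) = 1 + t * (c * x $ y) + t\<^sup>2 * R t (x::real^'a)"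
    using exp_expansion[of c y] by blast
  then show ?thesis by (intro expandsI[of _ _ R]) (auto intro!: tame_intros)
qed

lemma expands_cong:
  assumes "expands T A B" "\<And>t x. T t x = T' t x" "\<And>x. A x = A' x" "\<And>x. B x = B' x"
  shows "expands T' A' B'"
proof -
  have "T = T'" "A = A'" "B = B'" using assms(2-4) by auto
  with assms(1) show ?thesis by simp
qed

lemma eq_0_if_bounded_by_multiples:
  fixes D :: real
  assumes "\<And>t. 0 < t \<Longrightarrow> t \<le> 1 \<Longrightarrow> \<bar>D\<bar> \<le> t * K"
  shows "D = 0"
proof -
  have "\<bar>D\<bar> \<le> 0"
  proof (rule field_le_epsilon)
    fix \<epsilon> :: real assume \<epsilon>: "\<epsilon> > 0"
    have K: "K \<ge> 0" using assms[of 1] by simp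
    define t where "t = min 1 (\<epsilon> / (K + 1))"
    have t: "0 < t" "t \<le> 1" "t \<le> \<epsilon> / (K + 1)" using \<epsilon> K by (auto simp: t_def)
    have "t * K \<le> t * (K + 1)" using t by simp
    also have "\<dots> \<le> \<epsilon>" using t(3) K by (simp add: field_simps)
    finally show "\<bar>D\<bar> \<le> 0 + \<epsilon>" using assms[OF t(1,2)] by simp
  qed
  then show ?thesis by simp
qed

text \<open>At a fixed point the remainders differ by a bounded amount. Setting t = 0 compares the
  first coefficients; dividing by t and letting t tend to 0 compares the second.\<close>

lemma expands_unique:
  assumes "expands T A B" "expands T A' B'"
  shows "A x = A' x" "B x = B' x"
proof -
  from assms(1) obtain C where C: "tame C"
    "\<And>t x. T t x = A x + t * B x + t\<^sup>2 * C t x" by (rule expandsE) blast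
  from assms(2) obtain C' where C': "tame C'"
    "\<And>t x. T t x = A' x + t * B' x + t\<^sup>2 * C' t x" by (rule expandsE) blast
  show A: "A x = A' x" using C(2)[of 0 x] C'(2)[of 0 x] by simp
  obtain K where K: "\<And>t. \<bar>t\<bar> \<le> 1 \<Longrightarrow> \<bar>C t x - C' t x\<bar> \<le> K"
    using tame_bounded[OF tame_diff2[OF C(1) C'(1)]] by blast
  have "B x - B' x = 0"
  proof (rule eq_0_if_bounded_by_multiples)
    fix t :: real assume t: "0 < t" "t \<le> 1"
    have "t * (B' x - B x) = t\<^sup>2 * (C t x - C' t x)"
      using C(2)[of t x] C'(2)[of t x] A by (simp add: algebra_simps)
    then have "B' x - B x = t * (C t x - C' t x)" using t by (simp add: power2_eq_square)
    then have "\<bar>B x - B' x\<bar> = t * \<bar>C t x - C' t x\<bar>"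
      using t by (metis abs_minus_commute abs_mult abs_of_pos)
    then show "\<bar>B x - B' x\<bar> \<le> t * K" using K[of t] t by (simp add: mult_left_mono)
  qed
  then show "B x = B' x" by simp
qed

subsection \<open>Lie derivatives\<close>

definition lie :: "(real^'n::finite \<Rightarrow> 'n \<Rightarrow> real) \<Rightarrow> 'n lfield \<Rightarrow> 'n lfield" where
  "lie X T x is = (\<Sum>b\<in>UNIV. X x b * pd b (\<lambda>y. T y is) x) +
     (\<Sum>j<length is. \<Sum>b\<in>UNIV. pd (is ! j) (\<lambda>y. X y b) x * T x (is[j := b]))"

lemma tamef_lie:
  assumes "\<And>b. tamef (\<lambda>x. X x b)" "\<And>is. length is = r \<Longrightarrow> tamef (\<lambda>x. T x is)" "length is = r"
  shows "tamef (\<lambda>x. lie X T x is)"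
  unfolding lie_def using assms
  by (intro tame_intros tame_pd[of "\<lambda>_. _"]) auto

lemma lie_add:
  assumes "tamef (\<lambda>x. S x is)" "tamef (\<lambda>x. T x is)"
  shows "lie X (\<lambda>x is. S x is + T x is) x is = lie X S x is + lie X T x is"
  using assms by (simp add: lie_def pd_add' sum.distrib algebra_simps)

lemma lie_tprod:
  assumes S: "tamef (\<lambda>x. S x (take r is))" and T: "tamef (\<lambda>x. T x (drop r is))" and r: "r \<le> length is"
  shows "lie X (tprod r S T) x is =
    lie X S x (take r is) * T x (drop r is) + S x (take r is) * lie X T x (drop r is)"
proof -
  let ?f = "\<lambda>j. \<Sum>b\<in>UNIV. pd (is ! j) (\<lambda>y. X y b) x * tprod r S T x (is[j := b])"
  have split: "{..<length is} = {..<r} \<union> (+) r ` {..<length is - r}"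
    using r by (auto simp: image_iff) (metis add_diff_inverse_nat diff_less_mono lessThan_iff not_less)
  have "sum ?f {..<length is} = sum ?f {..<r} + sum ?f ((+) r ` {..<length is - r})"
    unfolding split by (rule sum.union_disjoint) auto
  also have "sum ?f ((+) r ` {..<length is - r}) = (\<Sum>j<length is - r. ?f (r + j))"
    by (subst sum.reindex) auto
  also have "\<dots> = S x (take r is) * (\<Sum>j<length is - r. \<Sum>b\<in>UNIV.
      pd (drop r is ! j) (\<lambda>y. X y b) x * T x ((drop r is)[j := b]))"
    using r by (simp add: tprod_def sum_distrib_left drop_update_swap mult_ac)
  also have "sum ?f {..<r} = (\<Sum>j<r. \<Sum>b\<in>UNIV.
      pd (take r is ! j) (\<lambda>y. X y b) x * S x ((take r is)[j := b])) * T x (drop r is)"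
    using r by (simp add: tprod_def sum_distrib_left sum_distrib_right take_update_swap mult_ac)
  finally have B: "sum ?f {..<length is} = (\<Sum>j<r. \<Sum>b\<in>UNIV.
      pd (take r is ! j) (\<lambda>y. X y b) x * S x ((take r is)[j := b])) * T x (drop r is) +
      S x (take r is) * (\<Sum>j<length is - r. \<Sum>b\<in>UNIV.
      pd (drop r is ! j) (\<lambda>y. X y b) x * T x ((drop r is)[j := b]))" .
  have "(\<Sum>b\<in>UNIV. X x b * pd b (\<lambda>y. tprod r S T y is) x) =
    (\<Sum>b\<in>UNIV. X x b * pd b (\<lambda>y. S y (take r is)) x) * T x (drop r is) +
    S x (take r is) * (\<Sum>b\<in>UNIV. X x b * pd b (\<lambda>y. T y (drop r is)) x)"
    using S T by (simp add: tprod_def pd_mult' sum_distrib_left sum_distrib_right sum.distrib algebra_simps)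
  with B r show ?thesis by (simp add: lie_def min_absorb2 algebra_simps)
qed

lemma permute_list_update:
  assumes "\<sigma> permutes {..<length is}" "j < length is"
  shows "permute_list \<sigma> (is[\<sigma> j := b]) = (permute_list \<sigma> is)[j := b]"
proof (rule nth_equalityI)
  fix i assume "i < length (permute_list \<sigma> (is[\<sigma> j := b]))"
  then have i: "i < length is" by simp
  have "\<sigma> i < length is" "\<sigma> j < length is" using assms i permutes_in_image[OF assms(1)] by auto
  moreover have "\<sigma> i = \<sigma> j \<longleftrightarrow> i = j" using permutes_inj[OF assms(1)] by (auto dest: injD)
  ultimately show "permute_list \<sigma> (is[\<sigma> j := b]) ! i = (permute_list \<sigma> is)[j := b] ! i"
    using i assms by (auto simp: permute_list_nth nth_list_update)
qed simp

text \<open>The slots are merely renumbered by \<open>\<sigma>\<close>, and the sum over all slots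
  does not notice this.\<close>

lemma lie_permute:
  assumes "\<sigma> permutes {..<length is}"
  shows "lie X (\<lambda>x is. T x (permute_list \<sigma> is)) x is = lie X T x (permute_list \<sigma> is)"
proof -
  have "(\<Sum>j<length is. \<Sum>b\<in>UNIV. pd (permute_list \<sigma> is ! j) (\<lambda>y. X y b) x * T x ((permute_list \<sigma> is)[j := b])) =
    (\<Sum>j<length is. \<Sum>b\<in>UNIV. pd (is ! \<sigma> j) (\<lambda>y. X y b) x * T x (permute_list \<sigma> (is[\<sigma> j := b])))"
    using assms by (intro sum.cong) (auto simp: permute_list_update permute_list_nth)
  also have "\<dots> = (\<Sum>j<length is. \<Sum>b\<in>UNIV. pd (is ! j) (\<lambda>y. X y b) x * T x (permute_list \<sigma> (is[j := b])))"
    using sum.permute[OF assms, of "\<lambda>j. \<Sum>b\<in>UNIV. pd (is ! j) (\<lambda>y. X y b) x * T x (permute_list \<sigma> (is[j := b]))"]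
    by (simp add: o_def)
  finally show ?thesis by (simp add: lie_def)
qed

lemma matrix_inv_eqI:
  fixes A B :: "real^'n::finite^'n"
  assumes "A ** B = mat 1"
  shows "matrix_inv A = B"
  unfolding matrix_inv_def
proof (rule some_equality)
  show "A ** B = mat 1 \<and> B ** A = mat 1" using assms matrix_left_right_inverse by blast
  show "C = B" if "A ** C = mat 1 \<and> C ** A = mat 1" for C
    using that assms by (metis matrix_mul_assoc matrix_mul_lid matrix_mul_rid)
qed

subsection \<open>Conformally flat metrics with linear conformal factor\<close>

text \<open>The \<open>eps i\<close> are the diagonal entries, 1 or -1, of a flat metric of
  arbitrary signature, which is therefore its own inverse matrix; \<open>y\<close> is the coordinate
  in the conformal factor.\<close>

locale flat_signs =
  fixes eps :: "'n::finite \<Rightarrow> real" and y :: 'n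
  assumes eps_sq [simp]: "eps i * eps i = 1"
begin

lemma eps_sq_left [simp]: "eps i * (eps i * a) = a"
  by (simp flip: mult.assoc)

definition cmet :: "real \<Rightarrow> 'n lfield" where
  "cmet s x is = exp (2 * s * x $ y) * (if is ! 0 = is ! 1 then eps (is ! 0) else 0)"

abbreviation "flat \<equiv> cmet 0"

text \<open>The change of the Levi-Civita connection when a flat g is replaced by e^(2y) g:
  delta^b_d d_a y + delta^b_a d_d y - g_ad grad^b y. It is constant in x because y is
  linear.\<close>

definition gam :: "'n \<Rightarrow> 'n \<Rightarrow> 'n \<Rightarrow> real" where
  "gam b a d = (if a = y \<and> b = d then 1 else 0) + (if d = y \<and> a = b then 1 else 0) -
     (if b = y \<and> a = d then eps a * eps b else 0)"

lemma tame_cmet: "tame (\<lambda>t x. cmet (t * c) x is)"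
  using tame_scaled_exp[of "\<lambda>_. if is ! 0 = is ! 1 then eps (is ! 0) else 0"
      "\<bar>if is ! 0 = is ! 1 then eps (is ! 0) else 0\<bar>" "2 * c" y]
  by (simp add: cmet_def mult_ac)

lemma pd_cmet: "pd i (\<lambda>x. cmet s x is) x = (if i = y then 2 * s * cmet s x is else 0)"
proof -
  let ?e = "if is ! 0 = is ! 1 then eps (is ! 0) else 0"
  have "((\<lambda>z. exp (2 * s * z) * ?e) has_real_derivative 2 * s * (exp (2 * s * z) * ?e)) (at z)" for z
    by (auto intro!: derivative_eq_intros)
  from pd_comp_coord(1)[OF this, of i y] show ?thesis
    by (simp add: cmet_def)
qed

lemma cmet_pair: "cmet s x [a, b] = exp (2 * s * x $ y) * (if a = b then eps a else 0)"
  by (simp add: cmet_def)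

lemma ginv_cmet: "ginv (cmet s) x i j = (if i = j then exp (- (2 * s * x $ y)) * eps i else 0)"
proof -
  have 1: "gmat (cmet s) x ** (\<chi> i j. if i = j then exp (- (2 * s * x $ y)) * eps i else 0) = mat 1"
  proof -
    have "exp z * eps i * (exp (- z) * eps i) = (exp z * exp (- z)) * (eps i * eps i)" for z i
      by (simp only: mult_ac)
    then have "exp z * eps i * (exp (- z) * eps i) = 1" for z i
      by (simp add: exp_minus_inverse)
    then show ?thesis
      by (auto simp: vec_eq_iff matrix_matrix_mult_def gmat_def cmet_pair mat_def
          if_distrib[of "\<lambda>z. _ * z"] if_distrib[of "\<lambda>z. z * _"] cong: if_cong)
  qed
  then have "matrix_inv (gmat (cmet s) x) = (\<chi> i j. if i = j then exp (- (2 * s * x $ y)) * eps i else 0)"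
    by (rule matrix_inv_eqI)
  then show ?thesis by (simp add: ginv_def)
qed

lemma christoffel_cmet: "christoffel (cmet s) x b a d = s * gam b a d"
proof -
  have "christoffel (cmet s) x b a d = exp (- (2 * s * x $ y)) * eps b *
     (pd a (\<lambda>x. cmet s x [b, d]) x + pd d (\<lambda>x. cmet s x [a, b]) x - pd b (\<lambda>x. cmet s x [a, d]) x) / 2"
    unfolding christoffel_def ginv_cmet
    by (simp add: if_distrib[of "\<lambda>z. z * _"] cong: if_cong)
  also have "\<dots> = (exp (2 * s * x $ y) * exp (- (2 * s * x $ y))) * (eps b *
     ((if a = y \<and> b = d then s * eps b else 0) + (if d = y \<and> a = b then s * eps a else 0) -
      (if b = y \<and> a = d then s * eps a else 0)))"
  proof -
    have P: "pd i (\<lambda>x. cmet s x [p, q]) x = 2 * exp (2 * s * x $ y) * (if i = y \<and> p = q then s * eps p else 0)" for i p q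
      unfolding pd_cmet by (simp add: cmet_pair)
    have "E' * e * (2 * E * u + 2 * E * v - 2 * E * w) / 2 = E * E' * (e * (u + v - w))"
      for E E' e u v w :: real by (simp add: algebra_simps diff_divide_distrib add_divide_distrib)
    then show ?thesis unfolding P by blast
  qed
  also have "eps b * ((if a = y \<and> b = d then s * eps b else 0) + (if d = y \<and> a = b then s * eps a else 0) -
      (if b = y \<and> a = d then s * eps a else 0)) = s * gam b a d"
    by (simp add: gam_def right_diff_distrib distrib_left mult_ac)
  also have "exp (2 * s * x $ y) * exp (- (2 * s * x $ y)) * (s * gam b a d) = s * gam b a d"
    by (simp add: exp_minus_inverse)
  finally show ?thesis .
qed

lemma nabla_cmet: "nabla (cmet s) T x is = pd (hd is) (\<lambda>y. T y (tl is)) x -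
    s * (\<Sum>j<length (tl is). \<Sum>b\<in>UNIV. gam b (hd is) (tl is ! j) * T x ((tl is)[j := b]))"
  by (simp add: nabla_def christoffel_cmet sum_distrib_left mult.assoc)

text \<open>The Christoffel symbols are constant in x and proportional to s, so only the terms
  quadratic in them survive. Curvature therefore vanishes for the flat metric and has no first order
  variation in s.\<close>

lemma riemann_cmet:
  obtains \<rho> where "\<And>s x is. riemann (cmet s) x is = s\<^sup>2 * (exp (2 * s * x $ y) * \<rho> is)"
proof
  fix s x "is"
  show "riemann (cmet s) x is = s\<^sup>2 * (exp (2 * s * x $ y) *
      (\<Sum>m\<in>UNIV. (if is ! 3 = m then eps (is ! 3) else 0) * (\<Sum>p\<in>UNIV.
         gam m (is ! 0) p * gam p (is ! 1) (is ! 2) - gam m (is ! 1) p * gam p (is ! 0) (is ! 2))))"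
  proof -
    have "(\<Sum>p\<in>UNIV. s * gam m a p * (s * gam p b d) - s * gam m b p * (s * gam p a d)) =
        s\<^sup>2 * (\<Sum>p\<in>UNIV. gam m a p * gam p b d - gam m b p * gam p a d)" for m a b d
      by (simp add: sum_distrib_left power2_eq_square algebra_simps)
    then show ?thesis
      unfolding riemann_def Let_def christoffel_cmet cmet_pair
      by (simp add: sum_distrib_left mult_ac cong: if_cong)
  qed
qed

lemma contract_cmet: "contract (cmet s) T x is = exp (- (2 * s * x $ y)) * (\<Sum>a\<in>UNIV. eps a * T x (a # a # is))"
  unfolding contract_def ginv_cmet
  by (simp add: if_distrib[of "\<lambda>z. z * _"] sum_distrib_left mult.assoc cong: if_cong)

section \<open>Regularity and linearity of natural formulas on these metrics\<close>

lemma natural_tame: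
  assumes "natural k e r F" "\<And>is. tame (\<lambda>t x. u t x is)"
  shows "tame (\<lambda>t x. F (cmet (t * c)) (u t) x is)"
  using assms(1)
proof (induction arbitrary: "is")
  case curvature
  obtain \<rho> where \<rho>: "\<And>s x is. riemann (cmet s) x is = s\<^sup>2 * (exp (2 * s * x $ y) * \<rho> is)"
    using riemann_cmet by blast
  have "tame (\<lambda>t x. exp (t * (2 * c) * x $ y))" using tame_scaled_exp[of "\<lambda>_. 1" 1 "2 * c" y] by simp
  then have "tame (\<lambda>t x. (t * c)\<^sup>2 * (exp (t * (2 * c) * x $ y) * \<rho> is))"
    by (intro tame_intros) auto
  then show ?case unfolding \<rho> by (simp add: mult_ac)
next
  case (prod e r F e' r' G)
  then show ?case by (auto simp: tprod_def intro: tame_mult)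
next
  case (contr e r F)
  have "tame (\<lambda>t x. exp (t * (- 2 * c) * x $ y))" using tame_scaled_exp[of "\<lambda>_. 1" 1 "- 2 * c" y] by simp
  then have "tame (\<lambda>t x. exp (t * (- 2 * c) * x $ y) * (\<Sum>a\<in>UNIV. eps a * F (cmet (t * c)) (u t) x (a # a # is)))"
    using contr by (intro tame_intros) auto
  then show ?case unfolding contract_cmet by (simp add: mult_ac)
next
  case (deriv e r F)
  then show ?case unfolding nabla_cmet
    by (intro tame_intros tame_pd[of "\<lambda>t x. F (cmet (t * c)) (u t) x _"]) auto
qed (use assms(2) in \<open>auto intro: tame_add tame_cmet\<close>)

lemma natural_tamef:
  assumes "natural k e r F" "\<And>is. tamef (\<lambda>x. u x is)"
  shows "tamef (\<lambda>x. F (cmet s) u x is)"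
  using tame_const_fam[OF natural_tame[OF assms(1), of "\<lambda>_. u", OF assms(2)], of 1 s] by simp

lemma natural_0:
  assumes "natural k e r F" "e = 0"
  shows "F g u = F g w"
  using assms by induction auto

text \<open>In a product of total degree 1 one factor has degree 1 and the other has degree 0, hence
  is the same for all arguments; so linearity survives products.\<close>

lemma natural_add_scaled:
  assumes "natural k 1 r F" and u: "\<And>is. tamef (\<lambda>x. u x is)" and w: "\<And>is. tamef (\<lambda>x. w x is)"
  shows "F (cmet s) (\<lambda>x is. u x is + a * w x is) x is = F (cmet s) u x is + a * F (cmet s) w x is"
proof -
  let ?v = "\<lambda>x is. u x is + a * w x is"
  have "natural k e r F \<Longrightarrow> e = 1 \<Longrightarrow> F (cmet s) ?v = (\<lambda>x is. F (cmet s) u x is + a * F (cmet s) w x is)" for e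
  proof (induction rule: natural.induct)
    case (add e r F G)
    then show ?case by (auto simp: algebra_simps)
  next
    case (prod e r F e' r' G)
    then consider "e = 0" "e' = 1" | "e = 1" "e' = 0" by linarith
    then show ?case
    proof cases
      case 1
      have "F (cmet s) ?v = F (cmet s) w" "F (cmet s) u = F (cmet s) w"
        using natural_0[OF prod.hyps(1) 1(1)] by auto
      with 1 prod.IH show ?thesis by (auto simp: tprod_def fun_eq_iff algebra_simps)
    next
      case 2
      have "G (cmet s) ?v = G (cmet s) w" "G (cmet s) u = G (cmet s) w"
        using natural_0[OF prod.hyps(2) 2(2)] by auto
      with 2 prod.IH show ?thesis by (auto simp: tprod_def fun_eq_iff algebra_simps)
    qed
  next
    case (contr e r F)
    then show ?case by (auto simp: fun_eq_iff contract_cmet algebra_simps sum.distrib sum_distrib_left)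
  next
    case (deriv e r F)
    have "tamef (\<lambda>x. F (cmet s) u x is)" "tamef (\<lambda>x. F (cmet s) w x is)" for "is"
      using natural_tamef[OF deriv.hyps] u w by auto
    with deriv show ?case
      by (simp add: nabla_cmet fun_eq_iff pd_add' pd_cmult tame_intros algebra_simps sum.distrib sum_distrib_left)
  qed auto
  from this[OF assms(1)] show ?thesis by simp
qed

lemma natural_zero: "natural k 1 r F \<Longrightarrow> F (cmet s) (\<lambda>x is. 0) x is = 0"
  using natural_add_scaled[of k r F "\<lambda>_ _. 0" "\<lambda>_ _. 0" s 1 x "is"] by simp

lemma natural_scale:
  assumes "natural k 1 r F" "\<And>is. tamef (\<lambda>x. u x is)"
  shows "F (cmet s) (\<lambda>x is. a * u x is) x is = a * F (cmet s) u x is"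
  using natural_add_scaled[OF assms(1), of "\<lambda>_ _. 0" u s a x "is"] assms natural_zero by simp

lemma natural_sum:
  assumes "natural k 1 r F" "\<And>i is. i \<in> I \<Longrightarrow> tamef (\<lambda>x. u i x is)"
  shows "F (cmet s) (\<lambda>x is. \<Sum>i\<in>I. u i x is) x is = (\<Sum>i\<in>I. F (cmet s) (u i) x is)"
  using assms(2)
proof (induction I rule: infinite_finite_induct)
  case (insert i I)
  then show ?case
    using natural_add_scaled[OF assms(1), of "u i" "\<lambda>x is. \<Sum>i\<in>I. u i x is" s 1 x "is"]
    by (simp add: tame_sum)
qed (use natural_zero[OF assms(1)] in auto)

subsection \<open>Infinitesimal covariance of natural operators\<close>

text \<open>The second clause says that the Lie derivative of \<open>flat\<close> along
  \<open>X\<close> is 2 c y times \<open>flat\<close>. The third says that the Lie derivative of the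
  flat connection is c times \<open>gam\<close>, the first order change of the connection of
  \<open>cmet (t * c)\<close>. For c = 0 these are Killing fields.\<close>

definition conf_field :: "real \<Rightarrow> (real^'n \<Rightarrow> 'n \<Rightarrow> real) \<Rightarrow> bool" where
  "conf_field c X \<longleftrightarrow> (\<forall>b. tamef (\<lambda>x. X x b)) \<and>
     (\<forall>x a b. pd a (\<lambda>x. X x b) x * eps b + pd b (\<lambda>x. X x a) x * eps a =
        (if a = b then 2 * (c * x $ y) * eps a else 0)) \<and>
     (\<forall>x a d b. pd a (pd d (\<lambda>x. X x b)) x = c * gam b a d)"

text \<open>This is the Leibniz rule for contraction with the inverse metric, whose Lie derivative
  along \<open>X\<close> is -2 c y times itself.\<close>

lemma lie_contract:
  assumes X: "conf_field c X" and T: "\<And>a. tamef (\<lambda>x. T x (a # a # is))"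
  shows "lie X (contract flat T) x is = contract flat (lie X T) x is - 2 * (c * x $ y) * contract flat T x is"
proof -
  let ?D = "\<lambda>a b. pd a (\<lambda>x. X x b) x"
  \<comment> \<open>The conformal Killing equation with both indices raised, obtained by multiplying
    with \<open>eps a * eps b\<close>.\<close>
  have K: "eps a * ?D a b + eps b * ?D b a = (if a = b then 2 * (c * x $ y) * eps a else 0)" for a b
  proof -
    have E: "?D a b * eps b + ?D b a * eps a = (if a = b then 2 * (c * x $ y) * eps a else 0)"
      using X unfolding conf_field_def by blast
    have "eps a * ?D a b + eps b * ?D b a = eps a * ?D a b * (eps b * eps b) + eps b * ?D b a * (eps a * eps a)"
      by simp
    also have "\<dots> = eps a * eps b * (?D a b * eps b + ?D b a * eps a)"
      by (simp only: algebra_simps)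
    also have "\<dots> = (if a = b then 2 * (c * x $ y) * eps a else 0)"
      unfolding E by simp
    finally show ?thesis .
  qed
  have "(\<Sum>a\<in>UNIV. \<Sum>b\<in>UNIV. eps a * (?D a b * T x (b # a # is) + ?D a b * T x (a # b # is))) =
     (\<Sum>a\<in>UNIV. \<Sum>b\<in>UNIV. eps a * ?D a b * T x (b # a # is)) + (\<Sum>a\<in>UNIV. \<Sum>b\<in>UNIV. eps a * ?D a b * T x (a # b # is))"
    by (simp add: sum.distrib algebra_simps)
  also have "(\<Sum>a\<in>UNIV. \<Sum>b\<in>UNIV. eps a * ?D a b * T x (b # a # is)) = (\<Sum>a\<in>UNIV. \<Sum>b\<in>UNIV. eps b * ?D b a * T x (a # b # is))"
    by (rule sum.swap)
  also have "\<dots> + (\<Sum>a\<in>UNIV. \<Sum>b\<in>UNIV. eps a * ?D a b * T x (a # b # is)) =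
     (\<Sum>a\<in>UNIV. \<Sum>b\<in>UNIV. (eps a * ?D a b + eps b * ?D b a) * T x (a # b # is))"
    by (simp add: sum.distrib algebra_simps)
  also have "\<dots> = 2 * (c * x $ y) * (\<Sum>a\<in>UNIV. eps a * T x (a # a # is))"
    unfolding K by (simp add: if_distrib[of "\<lambda>z. z * _"] sum_distrib_left mult.assoc cong: if_cong)
  finally have two: "(\<Sum>a\<in>UNIV. \<Sum>b\<in>UNIV. eps a * (?D a b * T x (b # a # is) + ?D a b * T x (a # b # is))) =
     2 * (c * x $ y) * (\<Sum>a\<in>UNIV. eps a * T x (a # a # is))" .
  let ?R = "\<lambda>a. (\<Sum>j<length is. \<Sum>b\<in>UNIV. ?D (is ! j) b * T x (a # a # is[j := b]))"
  let ?T = "\<lambda>a. (\<Sum>b\<in>UNIV. X x b * pd b (\<lambda>y. T y (a # a # is)) x)"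
  \<comment> \<open>The two contracted slots contribute one gradient term each; after contraction
    they combine through \<open>two\<close> into the conformal factor.\<close>
  have "lie X T x (a # a # is) = ?T a +
     (\<Sum>b\<in>UNIV. ?D a b * T x (b # a # is) + ?D a b * T x (a # b # is)) + ?R a" for a
    by (simp add: lie_def sum.lessThan_Suc_shift sum.distrib algebra_simps del: sum.lessThan_Suc)
  then have "(\<Sum>a\<in>UNIV. eps a * lie X T x (a # a # is)) = (\<Sum>a\<in>UNIV. eps a * ?T a) +
     2 * (c * x $ y) * (\<Sum>a\<in>UNIV. eps a * T x (a # a # is)) + (\<Sum>a\<in>UNIV. eps a * ?R a)"
    unfolding two[symmetric] by (simp add: sum.distrib sum_distrib_left algebra_simps)
  moreover have "lie X (contract flat T) x is = (\<Sum>a\<in>UNIV. eps a * ?T a) + (\<Sum>a\<in>UNIV. eps a * ?R a)"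
  proof -
    have "(\<Sum>b\<in>UNIV. X x b * pd b (\<lambda>x. \<Sum>a\<in>UNIV. eps a * T x (a # a # is)) x) = (\<Sum>b\<in>UNIV. \<Sum>a\<in>UNIV. eps a * (X x b * pd b (\<lambda>x. T x (a # a # is)) x))"
      using T by (simp add: pd_sum tame_intros pd_cmult sum_distrib_left algebra_simps)
    also have "\<dots> = (\<Sum>a\<in>UNIV. eps a * ?T a)" by (subst sum.swap) (simp add: sum_distrib_left)
    finally have 1: "(\<Sum>b\<in>UNIV. X x b * pd b (\<lambda>x. \<Sum>a\<in>UNIV. eps a * T x (a # a # is)) x) = (\<Sum>a\<in>UNIV. eps a * ?T a)" .
    have "(\<Sum>j<length is. \<Sum>b\<in>UNIV. ?D (is ! j) b * (\<Sum>a\<in>UNIV. eps a * T x (a # a # is[j := b]))) =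
      (\<Sum>j<length is. \<Sum>b\<in>UNIV. \<Sum>a\<in>UNIV. eps a * (?D (is ! j) b * T x (a # a # is[j := b])))"
      by (simp add: sum_distrib_left algebra_simps)
    also have "\<dots> = (\<Sum>j<length is. \<Sum>a\<in>UNIV. \<Sum>b\<in>UNIV. eps a * (?D (is ! j) b * T x (a # a # is[j := b])))"
      by (intro sum.cong refl sum.swap)
    also have "\<dots> = (\<Sum>a\<in>UNIV. eps a * ?R a)"
      by (subst sum.swap) (simp add: sum_distrib_left)
    finally show ?thesis unfolding lie_def contract_cmet using 1 by simp
  qed
  ultimately show ?thesis by (simp add: contract_cmet)
qed

text \<open>The commutator of Lie derivative and covariant derivative is given by the Lie derivative
  of the connection, here the second derivatives of \<open>X\<close>, that is, c times
  \<open>gam\<close>. The terms with two derivatives of \<open>T\<close> cancel by symmetry.\<close>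

lemma lie_nabla:
  assumes X: "conf_field c X" and T: "\<And>is. length is = r \<Longrightarrow> tamef (\<lambda>x. T x is)" and r: "length is = r"
  shows "lie X (nabla flat T) x (a # is) = pd a (\<lambda>x. lie X T x is) x -
    c * (\<Sum>j<length is. \<Sum>b\<in>UNIV. gam b a (is ! j) * T x (is[j := b]))"
proof -
  let ?D = "\<lambda>a b. pd a (\<lambda>x. X x b)"
  have tX: "tamef (\<lambda>x. X x b)" for b using X by (auto simp: conf_field_def)
  have tD: "tamef (?D a b)" for a b using tame_pd[OF tX] .
  have Tu: "tamef (\<lambda>x. T x (is[j := b]))" "tamef (\<lambda>x. T x is)" for j b using T r by auto
  have tT: "tamef (pd b (\<lambda>x. T x is))" for b using tame_pd[OF Tu(2)] .
  have DD: "pd a (?D d b) x = c * gam b a d" for d b using X by (auto simp: conf_field_def)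
  have "pd a (\<lambda>x. lie X T x is) x =
    (\<Sum>b\<in>UNIV. ?D a b x * pd b (\<lambda>y. T y is) x + X x b * pd a (pd b (\<lambda>y. T y is)) x) +
    (\<Sum>j<length is. \<Sum>b\<in>UNIV. c * gam b a (is ! j) * T x (is[j := b]) +
        ?D (is ! j) b x * pd a (\<lambda>x. T x (is[j := b])) x)"
    unfolding lie_def using tX tD Tu tT
    by (simp add: pd_add' pd_sum pd_mult' tame_intros DD)
  moreover have "pd a (pd b (\<lambda>y. T y is)) = pd b (pd a (\<lambda>y. T y is))" for b
    using tame_comm[OF Tu(2)] .
  ultimately show ?thesis
    by (simp add: lie_def nabla_cmet sum.distrib sum_distrib_left sum.lessThan_Suc_shift algebra_simps
       del: sum.lessThan_Suc)
qed

text \<open>If \<open>L\<^sub>X g = 2 c y g\<close>, then both \<open>g\<close> and \<open>u\<close> move along the flow of \<open>X\<close> to first order in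
  \<open>t\<close>, and hence so does every natural expression in them.\<close>

lemma natural_variation:
  assumes F: "natural k e r F" and X: "conf_field c X"
    and u: "\<And>is. expands (\<lambda>t x. u t x is) (\<lambda>x. u0 x is) (\<lambda>x. lie X u0 x is)"
    and r: "length is = r"
  shows "expands (\<lambda>t x. F (cmet (t * c)) (u t) x is) (\<lambda>x. F flat u0 x is) (\<lambda>x. lie X (F flat u0) x is)"
  using F r
proof (induction arbitrary: "is")
  case (const a)
  then show ?case by (simp add: lie_def expands_const)
next
  case metric
  then obtain a b where ab: "is = [a, b]" by (auto simp: length_Suc_conv numeral_2_eq_2)
  let ?e = "if a = b then eps a else 0"
  have "pd a (\<lambda>x. X x b) x * eps b + pd b (\<lambda>x. X x a) x * eps a = (if a = b then 2 * (c * x $ y) * eps a else 0)" for x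
    using X by (auto simp: conf_field_def)
  then have L: "lie X flat x is = 2 * c * x $ y * ?e" for x
    by (simp add: lie_def ab cmet_def lessThan_Suc if_distrib[of "\<lambda>z. _ * z"] algebra_simps cong: if_cong)
  show ?case
    by (rule expands_cong[OF expands_cmult[OF expands_exp[of "2 * c" y], of ?e]])
       (simp add: ab cmet_pair mult_ac, simp add: ab cmet_pair, simp add: L mult_ac)
next
  case curvature
  \<comment> \<open>Curvature is of order t^2, so it belongs entirely to the remainder.\<close>
  obtain \<rho> where \<rho>: "\<And>s x is. riemann (cmet s) x is = s\<^sup>2 * (exp (2 * s * x $ y) * \<rho> is)"
    using riemann_cmet by blast
  have "tame (\<lambda>t x. exp (t * (2 * c) * x $ y))" using tame_scaled_exp[of "\<lambda>_. 1" 1 "2 * c" y] by simp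
  then have "tame (\<lambda>t x. c\<^sup>2 * (exp (t * (2 * c) * x $ y) * \<rho> is))"
    by (intro tame_intros) auto
  then show ?case
    by (rule expandsI[rotated 2]) (simp_all add: \<rho> lie_def power_mult_distrib mult_ac)
next
  case argument
  then show ?case using u by blast
next
  case (add e r F G)
  show ?case
    by (rule expands_cong[OF expands_add[OF add.IH(1)[OF add.prems] add.IH(2)[OF add.prems]]])
       (use expands_tamef[OF add.IH(1)[OF add.prems]] expands_tamef[OF add.IH(2)[OF add.prems]] in
         \<open>auto simp: lie_add\<close>)
next
  case (prod e r F e' r' G)
  then have l: "length (take r is) = r" "length (drop r is) = r'" "r \<le> length is" by auto
  note e1 = prod.IH(1)[OF l(1)] and e2 = prod.IH(2)[OF l(2)]
  have "lie X (tprod r (F flat u0) (G flat u0)) x is = lie X (F flat u0) x (take r is) * G flat u0 x (drop r is) +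
      F flat u0 x (take r is) * lie X (G flat u0) x (drop r is)" for x
    using expands_tamef(1)[OF e1] expands_tamef(1)[OF e2] l(3) by (rule lie_tprod)
  note L = this
  show ?case
    by (rule expands_cong[OF expands_mult[OF e1 e2]])
       (simp add: tprod_def, simp add: tprod_def, simp only: L)
next
  case (perm e r F \<sigma>)
  then have "expands (\<lambda>t x. F (cmet (t * c)) (u t) x (permute_list \<sigma> is)) (\<lambda>x. F flat u0 x (permute_list \<sigma> is))
     (\<lambda>x. lie X (F flat u0) x (permute_list \<sigma> is))" by simp
  with perm show ?case by (simp add: lie_permute)
next
  case (contr e r F)
  have IH: "expands (\<lambda>t x. F (cmet (t * c)) (u t) x (a # a # is)) (\<lambda>x. F flat u0 x (a # a # is))
     (\<lambda>x. lie X (F flat u0) x (a # a # is))" for a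
    by (rule contr.IH) (simp add: contr.prems)
  have "expands (\<lambda>t x. \<Sum>a\<in>UNIV. eps a * F (cmet (t * c)) (u t) x (a # a # is))
     (\<lambda>x. \<Sum>a\<in>UNIV. eps a * F flat u0 x (a # a # is)) (\<lambda>x. \<Sum>a\<in>UNIV. eps a * lie X (F flat u0) x (a # a # is))"
    by (intro expands_sum expands_cmult IH)
  note S = this
  \<comment> \<open>The inverse metric supplies the factor exp(-2 t c y), whose first order term is
    precisely the correction in \<open>lie_contract\<close>.\<close>
  show ?case
    by (rule expands_cong[OF expands_mult[OF expands_exp[of "- 2 * c" y] S]])
      (simp_all add: lie_contract[OF X] expands_tamef[OF IH], simp_all add: contract_cmet mult_ac)
next
  case (deriv e r F)
  then obtain a js where js: "is = a # js" "length js = r" by (cases "is") auto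
  note IH = deriv.IH
  have tF: "length is = r \<Longrightarrow> tamef (\<lambda>x. F flat u0 x is)" for "is" using expands_tamef(1)[OF IH] .
  \<comment> \<open>Here \<open>nabla\<close> is \<open>pd\<close> minus t c times the
    \<open>gam\<close> term, so that term enters at first order with the unperturbed tensor, as in
    \<open>lie_nabla\<close>.\<close>
  have "expands (\<lambda>t x. pd a (\<lambda>x. F (cmet (t * c)) (u t) x js) x + (- c) *
       (t * (\<Sum>j<length js. \<Sum>b\<in>UNIV. gam b a (js ! j) * F (cmet (t * c)) (u t) x (js[j := b]))))
     (\<lambda>x. pd a (\<lambda>x. F flat u0 x js) x + (- c) * 0) (\<lambda>x. pd a (\<lambda>x. lie X (F flat u0) x js) x + (- c) *
        (\<Sum>j<length js. \<Sum>b\<in>UNIV. gam b a (js ! j) * F flat u0 x (js[j := b])))"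
    using js(2)
    by (intro expands_add expands_cmult expands_pd[OF IH]
       expands_times_t[OF expands_sum[OF expands_sum[OF expands_cmult[OF IH]]]]) auto
  then show ?case
    by (rule expands_cong) (simp_all only: js(1) lie_nabla[OF X tF js(2)], simp_all add: nabla_cmet mult_ac)
qed

end

subsection \<open>Alternating tensors\<close>

abbreviation del :: "nat \<Rightarrow> 'a list \<Rightarrow> 'a list" where
  "del j is \<equiv> take j is @ drop (Suc j) is"

lemma nth_del: "j < length is \<Longrightarrow> i < length is - 1 \<Longrightarrow> del j is ! i = (if i < j then is ! i else is ! Suc i)"
  by (auto simp: nth_append min_def)

lemma mset_del: "j < length is \<Longrightarrow> mset is = add_mset (is ! j) (mset (del j is))"
  by (subst id_take_nth_drop[of j "is"]) auto

lemma permute_list_transpose: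
  assumes "i < length is" "j < length is"
  shows "permute_list (Transposition.transpose i j) is = is[i := is ! j, j := is ! i]"
  using assms
  by (intro nth_equalityI) (auto simp: permute_list_nth permutes_swap_id nth_list_update Transposition.transpose_def)

lemma alternatingD_transpose:
  assumes "alternating k t" "length is = k" "i < k" "j < k" "i \<noteq> j"
  shows "t (is[i := is ! j, j := is ! i]) = - t is"
  using assms permutes_swap_id[of i "{..<k}" j]
  by (auto simp: alternating_def sign_swap_id simp flip: permute_list_transpose)

lemma alternating_not_distinct:
  assumes "alternating k t" "length is = k" "\<not> distinct is"
  shows "t is = 0"
proof -
  obtain i j where "i < k" "j < k" "i \<noteq> j" "is ! i = is ! j"
    using assms by (auto simp: distinct_conv_nth)
  then show ?thesis using alternatingD_transpose[OF assms(1,2), of i j]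
    by (metis add.inverse_inverse list_update_id neg_equal_zero)
qed

text \<open>Adjacent transpositions generate all permutations, and the permutations for which the
  sign rule \<open>P\<close> holds are closed under composition.\<close>

lemma alternating_adjacentI:
  assumes t: "\<And>is j. length is = k \<Longrightarrow> Suc j < k \<Longrightarrow> t (is[j := is ! Suc j, Suc j := is ! j]) = - t is"
  shows "alternating k t"
proof -
  define P where "P \<sigma> \<longleftrightarrow> (\<forall>is. length is = k \<longrightarrow> t (permute_list \<sigma> is) = of_int (sign \<sigma>) * t is)" for \<sigma>
  have comp: "P (\<sigma> \<circ> \<tau>)" if "P \<sigma>" "P \<tau>" "\<sigma> permutes {..<k}" "\<tau> permutes {..<k}" for \<sigma> \<tau>
    using that permutation_permutes[of \<sigma>] permutation_permutes[of \<tau>]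
    by (auto simp: P_def permute_list_compose sign_compose)
  have adj: "P (Transposition.transpose j (Suc j))" if "Suc j < k" for j
    using that t by (auto simp: P_def permute_list_transpose sign_swap_id)
  have tr: "P (Transposition.transpose i (i + Suc m))" if "i + Suc m < k" for i m
    using that
  proof (induction m)
    case 0 then show ?case using adj[of i] by simp
  next
    case (Suc m)
    let ?j = "i + Suc m"
    \<comment> \<open>Conjugating by an adjacent transposition lengthens the distance between the
      exchanged positions by one.\<close>
    have eq: "Transposition.transpose i (Suc ?j) = Transposition.transpose ?j (Suc ?j) \<circ> Transposition.transpose i ?j \<circ> Transposition.transpose ?j (Suc ?j)"
      by (auto simp: fun_eq_iff Transposition.transpose_def)
    moreover have "P (Transposition.transpose ?j (Suc ?j) \<circ> Transposition.transpose i ?j \<circ> Transposition.transpose ?j (Suc ?j))"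
      using Suc by (intro comp permutes_compose permutes_swap_id adj Suc.IH) auto
    ultimately have "P (Transposition.transpose i (Suc ?j))" by (simp only:)
    then show ?case by simp
  qed
  have trans: "P (Transposition.transpose i j)" if "i < k" "j < k" for i j
  proof (cases i j rule: linorder_cases)
    case less
    then show ?thesis using tr[of i "j - Suc i"] that by simp
  next
    case equal
    then show ?thesis by (simp add: P_def)
  next
    case greater
    then show ?thesis using tr[of j "i - Suc j"] that by (simp add: transpose_commute)
  qed
  have "P \<sigma>" if "\<sigma> permutes {..<k}" for \<sigma>
    using finite_lessThan that
  proof (induction rule: permutes_rev_induct)
    case id
    then show ?case by (simp add: P_def)
  next
    case (swap a b p)
    then show ?case by (intro comp trans permutes_swap_id) auto
  qed
  then show ?thesis by (auto simp: alternating_def P_def)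
qed

text \<open>The exterior product of dx_a with t, dx_a on the left, expanded over the slot that
  receives dx_a.\<close>

definition wedge :: "'n \<Rightarrow> 'n tensor \<Rightarrow> 'n tensor" where
  "wedge a t is = (\<Sum>j<length is. if is ! j = a then (-1) ^ j * t (del j is) else 0)"

text \<open>The form \<open>dx\<^sub>a\<^sub>1 \<and> \<dots> \<and> dx\<^sub>a\<^sub>k\<close> for a list of indices.\<close>

primrec dxs :: "'n list \<Rightarrow> 'n tensor" where
  "dxs [] = (\<lambda>is. if is = [] then 1 else 0)"
| "dxs (a # as) = wedge a (dxs as)"

lemma wedge_nonzeroE:
  assumes "wedge a t is \<noteq> 0"
  obtains j where "j < length is" "is ! j = a" "t (del j is) \<noteq> 0"
proof -
  obtain j where "j \<in> {..<length is}" "(if is ! j = a then (-1) ^ j * t (del j is) else 0) \<noteq> 0"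
    using assms unfolding wedge_def by (rule sum.not_neutral_contains_not_neutral)
  then show thesis using that by (auto split: if_splits)
qed

text \<open>Each wedge factor consumes one slot holding its own coordinate.\<close>

lemma dxs_support: "dxs I is \<noteq> 0 \<Longrightarrow> mset is = mset I"
proof (induction I arbitrary: "is")
  case Nil
  then show ?case by (auto split: if_splits)
next
  case (Cons a I)
  then obtain j where j: "j < length is" "is ! j = a" "dxs I (del j is) \<noteq> 0"
    by (auto elim: wedge_nonzeroE)
  then show ?case using Cons.IH[OF j(3)] mset_del[OF j(1)] by simp
qed

lemma dxs_eq_0: "a \<in> set is \<Longrightarrow> a \<notin> set I \<Longrightarrow> dxs I is = 0"
  using dxs_support mset_eq_setD by metis

lemma wedge_Cons_same: "a \<notin> set is \<Longrightarrow> wedge a t (a # is) = t is"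
proof -
  assume "a \<notin> set is"
  then have "is ! j \<noteq> a" if "j < length is" for j using that nth_mem by blast
  then show ?thesis by (simp add: wedge_def sum.lessThan_Suc_shift del: sum.lessThan_Suc)
qed

lemma dxs_self: "distinct I \<Longrightarrow> dxs I I = 1"
  by (induction I) (auto simp: wedge_Cons_same)

text \<open>Under exchange of slots m and m + 1, the summand for slot j is matched with that for the
  transposed slot. For j in {m, m + 1} the remaining lists agree and the sign (-1)^j flips;
  otherwise \<open>t\<close> itself changes sign.\<close>

lemma alternating_wedge:
  assumes t: "alternating k t"
  shows "alternating (Suc k) (wedge a t)"
proof (rule alternating_adjacentI)
  fix "is" :: "'a list" and m assume l: "length is = Suc k" and m: "Suc m < Suc k"
  define sw where "sw = is[m := is ! Suc m, Suc m := is ! m]"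
  define f where "f is j = (if is ! j = a then (-1) ^ j * t (del j is) else 0)" for "is" j
  have lsw: "length sw = Suc k" by (simp add: sw_def l)
  have nth_sw: "sw ! i = (if i = m then is ! Suc m else if i = Suc m then is ! m else is ! i)" if "i < Suc k" for i
    using that l m by (simp add: sw_def nth_list_update)
  have *: "f sw (Transposition.transpose m (Suc m) j) = - f is j" if j: "j < Suc k" for j
  proof -
    consider "j = m" | "j = Suc m" | "j < m" | "j > Suc m" by linarith
    then show ?thesis
    proof cases
      case 1
      have "del (Suc m) sw = del m is"
      proof (rule nth_equalityI)
        fix i assume "i < length (del (Suc m) sw)"
        then have "i < k" using lsw m by simp
        then show "del (Suc m) sw ! i = del m is ! i"
          using l lsw m by (cases i m rule: linorder_cases) (simp_all add: nth_sw nth_del)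
      qed (use l lsw m in simp)
      then show ?thesis using 1 l m by (simp add: f_def nth_sw)
    next
      case 2
      have "del m sw = del (Suc m) is"
      proof (rule nth_equalityI)
        fix i assume "i < length (del m sw)"
        then have "i < k" using lsw m by simp
        then show "del m sw ! i = del (Suc m) is ! i"
          using l lsw m by (cases i m rule: linorder_cases) (simp_all add: nth_sw nth_del)
      qed (use l lsw m in simp)
      then show ?thesis using 2 l m by (simp add: f_def nth_sw)
    next
      case 3
      let ?d = "del j is"
      have ld: "length ?d = k" using l j by simp
      \<comment> \<open>Deleting a slot before m moves the exchanged pair down by one place.\<close>
      have "del j sw = ?d[m - 1 := ?d ! Suc (m - 1), Suc (m - 1) := ?d ! (m - 1)]"
        by (rule nth_equalityI) (use l lsw m 3 in \<open>auto simp: nth_sw nth_del nth_list_update\<close>)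
      also have "t \<dots> = - t ?d"
        by (rule alternatingD_transpose[OF t ld]) (use m 3 in auto)
      finally have "t (del j sw) = - t ?d" .
      moreover have "sw ! j = is ! j" "Transposition.transpose m (Suc m) j = j" using 3 by (auto simp: sw_def Transposition.transpose_def)
      ultimately show ?thesis by (simp add: f_def)
    next
      case 4
      let ?d = "del j is"
      have ld: "length ?d = k" using l j by simp
      have "del j sw = ?d[m := ?d ! Suc m, Suc m := ?d ! m]"
        by (rule nth_equalityI) (use l lsw m 4 j in \<open>auto simp: nth_sw nth_del nth_list_update\<close>)
      also have "t \<dots> = - t ?d"
        by (rule alternatingD_transpose[OF t ld]) (use m 4 j in auto)
      finally have "t (del j sw) = - t ?d" .
      moreover have "sw ! j = is ! j" "Transposition.transpose m (Suc m) j = j" using 4 by (auto simp: sw_def Transposition.transpose_def)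
      ultimately show ?thesis by (simp add: f_def)
    qed
  qed
  have "Transposition.transpose m (Suc m) permutes {..<Suc k}" using m by (intro permutes_swap_id) auto
  from sum.permute[OF this, of "f sw"]
  have "sum (f sw) {..<Suc k} = (\<Sum>j<Suc k. f sw (Transposition.transpose m (Suc m) j))" by (simp add: o_def)
  also have "\<dots> = - (\<Sum>j<Suc k. f is j)" unfolding sum_negf[symmetric] using * by (intro sum.cong) auto
  finally show "wedge a t (is[m := is ! Suc m, Suc m := is ! m]) = - wedge a t is"
    unfolding sw_def[symmetric] by (simp add: wedge_def f_def l lsw)
qed

lemma alternating_dxs: "alternating (length I) (dxs I)"
proof (induction I)
  case Nil
  then show ?case by (auto simp: alternating_def)
next
  case (Cons a I)
  then show ?case using alternating_wedge by simp
qed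

text \<open>A nonzero component would need an index list containing z twice, where an alternating
  tensor vanishes.\<close>

lemma wedge_dxs_same:
  assumes "z \<in> set I" shows "wedge z (dxs I) is = 0"
proof (rule ccontr)
  assume n: "wedge z (dxs I) is \<noteq> 0"
  then obtain j where j: "j < length is" "is ! j = z" "dxs I (del j is) \<noteq> 0" by (rule wedge_nonzeroE)
  have m: "mset (del j is) = mset I" using dxs_support[OF j(3)] .
  then have is_I: "mset is = add_mset z (mset I)" using mset_del[OF j(1)] j(2) by simp
  then have l: "length is = Suc (length I)" by (metis size_add_mset size_mset)
  have "\<not> distinct is"
  proof
    assume "distinct is"
    then have "count (mset is) z \<le> 1" by (simp add: distinct_count_atmost_1)
    moreover have "count (mset I) z > 0" using assms by simp
    ultimately show False using is_I by simp
  qed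
  with alternating_not_distinct[OF alternating_wedge[OF alternating_dxs] l] n show False by blast
qed

subsection \<open>Forms with a single component\<close>

definition frm :: "(real^'n::finite \<Rightarrow> real) \<Rightarrow> 'n list \<Rightarrow> 'n lfield" where
  "frm f I x is = f x * dxs I is"

lemma tamef_frm: "tamef f \<Longrightarrow> tamef (\<lambda>x. frm f I x is)"
  unfolding frm_def by (intro tame_intros) auto

lemma pd_frm: "tamef f \<Longrightarrow> pd a (\<lambda>x. frm f I x is) x = frm (pd a f) I x is"
  unfolding frm_def by (simp add: pd_cmult_right)

lemma ext_d_frm:
  assumes "tamef f"
  shows "ext_d (frm f I) x is = (\<Sum>a\<in>UNIV. pd a f x * wedge a (dxs I) is)"
proof -
  have "(\<Sum>a\<in>UNIV. pd a f x * wedge a (dxs I) is) =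
    (\<Sum>j<length is. \<Sum>a\<in>UNIV. if a = is ! j then pd a f x * ((-1) ^ j * dxs I (del j is)) else 0)"
    unfolding wedge_def sum_distrib_left by (subst sum.swap) (auto intro!: sum.cong)
  also have "\<dots> = ext_d (frm f I) x is"
    unfolding ext_d_def pd_frm[OF assms] unfolding frm_def by (auto intro!: sum.cong)
  finally show ?thesis by simp
qed

text \<open>In df wedge dx_I the terms with a in I repeat a differential, and the others have
  coefficient 0.\<close>

lemma ext_d_frm_closed:
  assumes "tamef f" "\<And>a. a \<notin> set I \<Longrightarrow> pd a f x = 0"
  shows "ext_d (frm f I) x is = 0"
  unfolding ext_d_frm[OF assms(1)]
  using assms(2) wedge_dxs_same[of _ I "is"] by (intro sum.neutral) auto

text \<open>The division by p! makes differentiation lower the exponent without producing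
  factors.\<close>

definition zpow :: "'n \<Rightarrow> nat \<Rightarrow> real^'n::finite \<Rightarrow> real" where
  "zpow z p x = (x $ z) ^ p / fact p"

lemma tamef_zpow [simp]: "tamef (zpow z p)"
  unfolding zpow_def by (intro tame_intros) auto

lemma pd_zpow: "pd a (zpow z p) = (if a = z \<and> p > 0 then zpow z (p - 1) else (\<lambda>x. 0))"
proof -
  have *: "((\<lambda>s. s ^ p / fact p) has_real_derivative (if p = 0 then 0 else s ^ (p - 1) / fact (p - 1))) (at s)" for s
  proof (cases p)
    case (Suc m)
    have "((\<lambda>s. s ^ Suc m / fact (Suc m)) has_real_derivative real (Suc m) * s ^ m / fact (Suc m)) (at s)"
      by (rule DERIV_cdivide) (use DERIV_pow[of "Suc m" s UNIV] in \<open>simp del: power_Suc of_nat_Suc\<close>)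
    moreover have "real (Suc m) * s ^ m / fact (Suc m) = s ^ m / fact m"
      by (simp only: fact_Suc of_nat_mult) (simp del: of_nat_Suc)
    ultimately show ?thesis using Suc by simp
  qed simp
  show ?thesis unfolding zpow_def by (subst pd_comp_coord(1)[OF *]) (auto simp: fun_eq_iff zpow_def)
qed

lemma foldr_pd_frm: "tamef f \<Longrightarrow> foldr pd as (\<lambda>x. frm f I x is) = (\<lambda>x. frm (foldr pd as f) I x is) \<and> tamef (foldr pd as f)"
proof (induction as)
  case (Cons a as)
  then have "tamef (foldr pd as f)" by blast
  with Cons show ?case by (auto simp: pd_frm intro: tame_pd[of "\<lambda>_. _"])
qed simp

text \<open>Fewer than p derivatives leave either 0 or a positive power, which vanishes at the
  origin. Operators of order less than p therefore cannot see this function there.\<close>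

lemma foldr_pd_zpow: "length as < p \<Longrightarrow> foldr pd as (zpow z p) 0 = 0"
proof -
  have "foldr pd as (zpow z p) \<in> {\<lambda>x. 0, zpow z (p - length as)}" if "length as \<le> p"
    using that
  proof (induction as)
    case (Cons a as)
    then have "foldr pd as (zpow z p) \<in> {\<lambda>x. 0, zpow z (p - length as)}" by simp
    then show ?case by (auto simp: pd_zpow)
  qed simp
  then show "length as < p \<Longrightarrow> foldr pd as (zpow z p) 0 = 0"
    by (force simp: zpow_def)
qed

context flat_signs
begin

section \<open>The codifferential and its composition with d on forms with a single
  component\<close>

lemma coderiv_frm:
  assumes "tamef f"
  shows "coderiv flat (frm f I) x is = - (\<Sum>a\<in>UNIV. eps a * pd a f x * dxs I (a # is))"
  using assms by (simp add: coderiv_def contract_cmet nabla_cmet pd_frm, simp add: frm_def mult.assoc)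

text \<open>A form f(z) dx_I with z in I is closed, so d delta acts on it as the form Laplacian,
  that is, as -eps_z times the second z-derivative.\<close>

lemma ext_d_coderiv_frm:
  assumes z: "z \<in> set I"
  shows "ext_d (coderiv flat (frm (\<lambda>x. c * zpow z (Suc (Suc p)) x) I)) = frm (\<lambda>x. (- eps z * c) * zpow z p x) I"
proof (intro ext)
  fix x "is"
  have "pd a (\<lambda>x. c * zpow z (Suc (Suc p)) x) = (\<lambda>x. if a = z then c * zpow z (Suc p) x else 0)" for a
    by (auto simp: pd_cmult pd_zpow)
  then have co: "coderiv flat (frm (\<lambda>x. c * zpow z (Suc (Suc p)) x) I) =
      (\<lambda>x is. (- eps z * c * dxs I (z # is)) * zpow z (Suc p) x)"
    by (simp add: fun_eq_iff coderiv_frm tame_intros if_distrib[of "\<lambda>v. _ * v"] if_distrib[of "\<lambda>v. v * _"] cong: if_cong)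
  \<comment> \<open>Expanding dz wedge dx_I = 0 with z in the first slot shows that dz wedge (the
    contraction of dx_I with the z-direction) is dx_I.\<close>
  have "0 = wedge z (dxs I) (z # is)" using wedge_dxs_same[OF z] by simp
  also have "\<dots> = dxs I is - (\<Sum>j<length is. if is ! j = z then (-1) ^ j * dxs I (z # del j is) else 0)"
    by (auto simp: wedge_def sum.lessThan_Suc_shift simp flip: sum_negf simp del: sum.lessThan_Suc intro!: sum.cong)
  finally have w: "(\<Sum>j<length is. if is ! j = z then (-1) ^ j * dxs I (z # del j is) else 0) = dxs I is" by simp
  have "ext_d (coderiv flat (frm (\<lambda>x. c * zpow z (Suc (Suc p)) x) I)) x is =
    (- eps z * c * zpow z p x) * (\<Sum>j<length is. if is ! j = z then (-1) ^ j * dxs I (z # del j is) else 0)"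
    unfolding co ext_d_def sum_distrib_left
    by (intro sum.cong refl) (simp only: pd_cmult[OF tamef_zpow], auto simp: pd_zpow)
  then show "ext_d (coderiv flat (frm (\<lambda>x. c * zpow z (Suc (Suc p)) x) I)) x is =
      frm (\<lambda>x. (- eps z * c) * zpow z p x) I x is"
    unfolding w by (simp add: frm_def)
qed

lemma funpow_ext_d_coderiv_frm:
  assumes z: "z \<in> set I"
  shows "((\<lambda>v. ext_d (coderiv flat v)) ^^ m) (frm (\<lambda>x. c * zpow z (2 * m + p) x) I) =
    frm (\<lambda>x. ((- eps z) ^ m * c) * zpow z p x) I"
proof (induction m arbitrary: c)
  case (Suc m)
  have "ext_d (coderiv flat (frm (\<lambda>x. c * zpow z (2 * Suc m + p) x) I)) =
      frm (\<lambda>x. (- eps z * c) * zpow z (2 * m + p) x) I"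
    using ext_d_coderiv_frm[OF z, of c "2 * m + p"] by simp
  moreover have "(- eps z) ^ m * (- eps z * c) = (- eps z) ^ Suc m * c" by simp
  ultimately show ?case by (simp only: funpow_Suc_right o_apply Suc.IH)
qed simp

subsection \<open>Parity\<close>

text \<open>This is the reflection x_w -> -x_w, carried out by induction on the formula. Constancy
  along w is proved simultaneously because it annihilates derivatives in direction w; contraction
  changes the number of indices w by an even number.\<close>

lemma natural_parity:
  assumes "natural k e r F" "length is = r"
    and u: "\<And>is. tamef (\<lambda>x. u x is)" "\<And>is. pd w (\<lambda>x. u x is) = (\<lambda>x. 0)"
      "\<And>x is. w \<in> set is \<Longrightarrow> u x is = 0"
  shows "pd w (\<lambda>x. F flat u x is) = (\<lambda>x. 0) \<and> (odd (count (mset is) w) \<longrightarrow> (\<forall>x. F flat u x is = 0))"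
  using assms(1,2)
proof (induction arbitrary: "is")
  case metric
  then obtain a b where ab: "is = [a, b]" by (auto simp: length_Suc_conv numeral_2_eq_2)
  then show ?case by (auto simp: pd_cmet cmet_pair)
next
  case curvature
  obtain \<rho> where "\<And>s x is. riemann (cmet s) x is = s\<^sup>2 * (exp (2 * s * x $ y) * \<rho> is)"
    using riemann_cmet by blast
  then show ?case by simp
next
  case argument
  then show ?case using u by (auto simp: count_eq_zero_iff) (metis even_zero not_in_iff set_mset_mset u(3))
next
  case (add e r F G)
  then show ?case using natural_tamef[OF add.hyps(1) u(1)] natural_tamef[OF add.hyps(2) u(1)]
    by (auto simp: pd_add')
next
  case (prod e r F e' r' G)
  have l: "length (take r is) = r" "length (drop r is) = r'" using prod.prems by auto
  have "mset is = mset (take r is) + mset (drop r is)" by (metis append_take_drop_id mset_append)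
  with prod.IH(1)[OF l(1)] prod.IH(2)[OF l(2)] show ?case
    using natural_tamef[OF prod.hyps(1) u(1)] natural_tamef[OF prod.hyps(2) u(1)]
    by (auto simp: tprod_def pd_mult')
next
  case (perm e r F \<sigma>)
  then show ?case using perm.IH[of "permute_list \<sigma> is"] by simp
next
  case (contr e r F)
  have IH: "pd w (\<lambda>x. F flat u x (a # a # is)) = (\<lambda>x. 0)"
    "odd (count (mset is) w) \<Longrightarrow> F flat u x (a # a # is) = 0" for a x
    using contr.IH[of "a # a # is"] contr.prems by (auto split: if_splits)
  show ?case using natural_tamef[OF contr.hyps(1) u(1), of 0] IH
    by (auto simp: contract_cmet pd_sum tame_intros pd_cmult)
next
  case (deriv e r F)
  then obtain a js where js: "is = a # js" "length js = r" by (cases "is") auto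
  note tF = natural_tamef[OF deriv.hyps(1) u(1), of 0]
  have "pd w (pd a (\<lambda>x. F flat u x js)) = pd a (pd w (\<lambda>x. F flat u x js))"
    using tame_comm[OF tF] .
  also have "\<dots> = (\<lambda>x. 0)" using deriv.IH[OF js(2)] by simp
  finally have 1: "pd w (pd a (\<lambda>x. F flat u x js)) = (\<lambda>x. 0)" .
  have "pd a (\<lambda>x. F flat u x js) x = 0" if "odd (count (mset is) w)" for x
  proof (cases "a = w")
    case False
    then have "(\<lambda>x. F flat u x js) = (\<lambda>x. 0)" using deriv.IH[OF js(2)] that js by auto
    then show ?thesis by simp
  qed (use deriv.IH[OF js(2)] in simp)
  with 1 show ?case by (simp add: nabla_cmet js)
qed auto

text \<open>Distinct indices in number k + 1 cannot all lie among the k entries of \<open>I\<close>.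
  One outside occurs exactly once, an odd number of times, and parity applies to it.\<close>

lemma natural_alternating_frm:
  assumes F: "natural k 1 (Suc k) F" and I: "length I = k"
    and f: "tamef f" "\<And>a. a \<notin> set I \<Longrightarrow> pd a f = (\<lambda>x. 0)"
    and alt: "alternating (Suc k) (F flat (frm f I) x)" and l: "length is = Suc k"
  shows "F flat (frm f I) x is = 0"
proof (cases "distinct is")
  case True
  have "card (set I) < card (set is)"
    using card_length[of I] I l distinct_card[OF True] by simp
  then have "\<not> set is \<subseteq> set I" using card_mono[of "set I" "set is"] by auto
  then obtain w where w: "w \<in> set is" "w \<notin> set I" by blast
  have "count (mset is) w = 1" using True w by (simp add: distinct_count_atmost_1)
  moreover have "pd w (\<lambda>x. frm f I x is) = (\<lambda>x. 0)" for "is"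
    by (rule ext) (simp add: pd_frm[OF f(1)] f(2)[OF w(2)], simp add: frm_def)
  moreover have "frm f I x is = 0" if "w \<in> set is" for x "is"
    using dxs_eq_0[OF that w(2)] by (simp add: frm_def)
  ultimately show ?thesis
    using natural_parity[OF F l tamef_frm[OF f(1)], of w] by simp
qed (rule alternating_not_distinct[OF alt l])

subsection \<open>Conformal vector fields\<close>

text \<open>y times the Euler field minus half of |x|^2 times the gradient of y: the generator of
  special conformal transformations in direction y.\<close>

definition special_conf :: "real^'n \<Rightarrow> 'n \<Rightarrow> real" where
  "special_conf x b = x $ y * x $ b - (if b = y then eps y / 2 else 0) * (\<Sum>i\<in>UNIV. eps i * (x $ i * x $ i))"

text \<open>The generator of rotations, or boosts, in the plane of the coordinates i and y.\<close>

definition rotation :: "'n \<Rightarrow> real^'n \<Rightarrow> 'n \<Rightarrow> real" where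
  "rotation i x b = (if b = i then 1 else 0) * x $ y - (if b = y then eps y * eps i else 0) * x $ i"

lemma pd_special_conf:
  "pd a (\<lambda>x. special_conf x b) = (\<lambda>x. (if a = y then 1 else 0) * x $ b + (if a = b then 1 else 0) * x $ y -
     (if b = y then eps y * eps a else 0) * x $ a)"
proof -
  have "pd a (\<lambda>x. \<Sum>i\<in>UNIV. eps i * (x $ i * x $ i)) = (\<lambda>x. \<Sum>i\<in>UNIV. eps i * (2 * (x $ i * (if a = i then 1 else 0))))"
    by (simp add: pd_sum tame_mult pd_cmult pd_mult' pd_coord fun_eq_iff)
  also have "\<dots> = (\<lambda>x. 2 * eps a * x $ a)"
    by (simp add: if_distrib[of "\<lambda>v. _ * v"] cong: if_cong) (simp add: mult_ac)
  finally have "pd a (\<lambda>x. \<Sum>i\<in>UNIV. eps i * (x $ i * x $ i)) = (\<lambda>x. 2 * eps a * x $ a)" .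
  then show ?thesis
    unfolding special_conf_def by (auto simp: pd_diff tame_intros pd_cmult pd_mult' pd_coord fun_eq_iff)
qed

lemma pd_rotation: "pd a (\<lambda>x. rotation i x b) =
    (\<lambda>x. (if b = i \<and> a = y then 1 else 0) - (if b = y \<and> a = i then eps y * eps i else 0))"
proof -
  have "pd a (\<lambda>x::real^'n. p * x $ y - q * x $ i) = (\<lambda>x. p * (if a = y then 1 else 0) - q * (if a = i then 1 else 0))" for p q
    by (simp add: pd_diff tame_mult pd_cmult pd_coord)
  moreover have "(if P then p else 0) * (if R then 1 else 0) = (if P \<and> R then p else 0)" for P R and p :: real
    by simp
  ultimately show ?thesis unfolding rotation_def by (simp only:)
qed

lemma conf_field_special_conf: "conf_field 1 special_conf"
  unfolding conf_field_def
proof (intro conjI allI)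
  show "tamef (\<lambda>x. special_conf x b)" for b unfolding special_conf_def by (intro tame_intros) auto
  show "pd a (\<lambda>x. special_conf x b) x * eps b + pd b (\<lambda>x. special_conf x a) x * eps a =
      (if a = b then 2 * (1 * x $ y) * eps a else 0)" for x a b
    by (auto simp: pd_special_conf algebra_simps)
  show "pd a (pd d (\<lambda>x. special_conf x b)) x = 1 * gam b a d" for x a d b
    by (auto simp: pd_special_conf pd_diff pd_add' tame_intros pd_cmult pd_coord gam_def)
qed

lemma conf_field_rotation:
  assumes "i \<noteq> y" shows "conf_field 0 (rotation i)"
  unfolding conf_field_def
proof (intro conjI allI)
  show "tamef (\<lambda>x. rotation i x b)" for b unfolding rotation_def by (intro tame_intros) auto
qed (use assms in \<open>auto simp: pd_rotation algebra_simps\<close>)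

text \<open>For c = 0 the metric stays flat, so \<open>natural_variation\<close> along u + t L_X u
  has first order term L_X F u. Linearity of F gives F L_X u for the same term.\<close>

lemma natural_lie_commute:
  assumes F: "natural k 1 r F" and X: "conf_field 0 X" and u: "\<And>is. tamef (\<lambda>x. u x is)"
    and r: "length is = r"
  shows "F flat (lie X u) x is = lie X (F flat u) x is"
proof -
  have tX: "tamef (\<lambda>x. X x b)" for b using X by (auto simp: conf_field_def)
  have tl: "tamef (\<lambda>x. lie X u x is)" for "is" by (rule tamef_lie[OF tX u refl])
  have "expands (\<lambda>t x. u x is + t * lie X u x is) (\<lambda>x. u x is) (\<lambda>x. lie X u x is)" for "is"
    by (rule expandsI[of _ _ "\<lambda>t x. 0"]) (auto simp: u tl)
  from natural_variation[OF F X this r]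
  have "expands (\<lambda>t x. F flat u x is + t * F flat (lie X u) x is) (\<lambda>x. F flat u x is) (\<lambda>x. lie X (F flat u) x is)"
    by (simp add: natural_add_scaled[OF F u tl])
  moreover have "expands (\<lambda>t x. F flat u x is + t * F flat (lie X u) x is) (\<lambda>x. F flat u x is) (\<lambda>x. F flat (lie X u) x is)"
    by (rule expandsI[of _ _ "\<lambda>t x. 0"]) (auto intro: natural_tamef[OF F] u tl)
  ultimately show ?thesis by (rule expands_unique(2)[symmetric])
qed

text \<open>A coordinate translation is a Killing field whose Lie derivative is just the partial
  derivative.\<close>

lemma natural_pd_commute:
  assumes F: "natural k 1 r F" and u: "\<And>is. tamef (\<lambda>x. u x is)" and r: "length is = r"
  shows "F flat (\<lambda>x is. pd a (\<lambda>x. u x is) x) x is = pd a (\<lambda>x. F flat u x is) x"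
proof -
  let ?X = "\<lambda>(x :: real^'n) b. if b = a then 1 else 0 :: real"
  have "conf_field 0 ?X" unfolding conf_field_def by simp
  note conf = this
  have "lie ?X v = (\<lambda>x is. pd a (\<lambda>x. v x is) x)" for v
    by (simp add: lie_def fun_eq_iff if_distrib[of "\<lambda>z. z * _"] cong: if_cong)
  then show ?thesis using natural_lie_commute[OF F conf u r] by (simp only:)
qed

section \<open>Lie derivatives of one-component forms along rotations and the special conformal
  field\<close>

lemma lie_rotation_frm:
  assumes f: "tamef f" "pd y f = (\<lambda>x. 0)" and I: "y \<notin> set I" "b \<in> set I"
  shows "lie (rotation b) (frm f I) x is = x $ y * pd b f x * dxs I is +
    f x * (\<Sum>j<length is. if is ! j = y then dxs I (is[j := b]) else 0)"
proof -
  have b_y: "b \<noteq> y" using I by blast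
  have "(\<Sum>c\<in>UNIV. rotation b x c * pd c (\<lambda>x. frm f I x is) x) =
    (\<Sum>c\<in>UNIV. if c = b then x $ y * pd b f x * dxs I is else 0)"
    using f(2) by (intro sum.cong) (auto simp: pd_frm[OF f(1)], auto simp: rotation_def frm_def)
  moreover have "(\<Sum>c\<in>UNIV. pd (is ! j) (\<lambda>x. rotation b x c) x * frm f I x (is[j := c])) =
      f x * (if is ! j = y then dxs I (is[j := b]) else 0)" if "j < length is" for j
  proof -
    have "dxs I (is[j := y]) = 0" by (rule dxs_eq_0[OF set_update_memI[OF that] I(1)])
    then have "(\<Sum>c\<in>UNIV. pd (is ! j) (\<lambda>x. rotation b x c) x * frm f I x (is[j := c])) =
      (\<Sum>c\<in>UNIV. if c = b then f x * (if is ! j = y then dxs I (is[j := b]) else 0) else 0)"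
      using b_y by (intro sum.cong) (auto simp: pd_rotation frm_def)
    then show ?thesis by simp
  qed
  ultimately show ?thesis by (simp add: lie_def sum_distrib_left)
qed

text \<open>This reduces the conformal field to Killing fields. The terms replacing an index y by b
  agree on both sides. The multiple |I| y f dx_I comes on the left from the gradient of the field,
  one y per slot, and on the right from rotation b acting on x_b, which gives y.\<close>

lemma lie_special_conf_frm:
  assumes f: "tamef f" "\<And>a. a \<noteq> z \<Longrightarrow> pd a f = (\<lambda>x. 0)"
    and I: "y \<notin> set I" "z \<in> set I" "distinct I"
  shows "lie special_conf (frm f I) x is =
    (\<Sum>b\<in>set I. lie (rotation b) (frm (\<lambda>x. f x * x $ b) I) x is)"
proof -
  define N where "N b = (\<Sum>j<length is. if is ! j = y then dxs I (is[j := b]) else 0)" for b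
  have zy: "z \<noteq> y" using I by blast
  have "(\<Sum>c\<in>UNIV. special_conf x c * pd c (\<lambda>x. frm f I x is) x) =
    (\<Sum>c\<in>UNIV. if c = z then x $ y * x $ z * pd z f x * dxs I is else 0)"
    using f(2) zy by (intro sum.cong) (auto simp: pd_frm[OF f(1)], auto simp: special_conf_def frm_def)
  then have A: "(\<Sum>c\<in>UNIV. special_conf x c * pd c (\<lambda>x. frm f I x is) x) = x $ y * x $ z * pd z f x * dxs I is"
    by simp
  have "(\<Sum>c\<in>UNIV. pd (is ! j) (\<lambda>x. special_conf x c) x * frm f I x (is[j := c])) =
      (\<Sum>c\<in>set I. f x * (x $ c * (if is ! j = y then dxs I (is[j := c]) else 0) +
         x $ y * (if is ! j = c then dxs I is else 0)))" if "j < length is" for j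
  \<comment> \<open>A replacement index outside \<open>I\<close> leaves the support of dx_I, so only
    c in \<open>I\<close> contributes.\<close>
  proof (rule sum.mono_neutral_cong_right)
    show "\<forall>c\<in>UNIV - set I. pd (is ! j) (\<lambda>x. special_conf x c) x * frm f I x (is[j := c]) = 0"
      using dxs_eq_0[OF set_update_memI[OF that]] by (simp add: frm_def)
    show "pd (is ! j) (\<lambda>x. special_conf x c) x * frm f I x (is[j := c]) =
      f x * (x $ c * (if is ! j = y then dxs I (is[j := c]) else 0) + x $ y * (if is ! j = c then dxs I is else 0))"
      if "c \<in> set I" for c
    proof -
      have "c \<noteq> y" using that I by blast
      then show ?thesis by (auto simp: pd_special_conf frm_def)
    qed
  qed auto
  then have "(\<Sum>j<length is. \<Sum>c\<in>UNIV. pd (is ! j) (\<lambda>x. special_conf x c) x * frm f I x (is[j := c])) =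
    (\<Sum>j<length is. \<Sum>c\<in>set I. f x * (x $ c * (if is ! j = y then dxs I (is[j := c]) else 0) +
         x $ y * (if is ! j = c then dxs I is else 0)))" by simp
  also have "\<dots> = (\<Sum>c\<in>set I. f x * x $ c * N c) +
      f x * x $ y * (\<Sum>j<length is. \<Sum>c\<in>set I. if is ! j = c then dxs I is else 0)"
  proof -
    have "(\<Sum>j<length is. \<Sum>c\<in>set I. f x * (x $ c * (if is ! j = y then dxs I (is[j := c]) else 0))) =
        (\<Sum>c\<in>set I. f x * x $ c * N c)"
      unfolding N_def sum_distrib_left by (subst sum.swap) (simp only: mult.assoc)
    then show ?thesis
      by (simp only: distrib_left sum.distrib) (simp only: sum_distrib_left mult.assoc)
  qed
  \<comment> \<open>Where dx_I is nonzero, \<open>is\<close> is a rearrangement of \<open>I\<close>,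
    so each slot matches exactly one c.\<close>
  also have "(\<Sum>j<length is. \<Sum>c\<in>set I. if is ! j = c then dxs I is else 0) = real (card (set I)) * dxs I is"
  proof (cases "dxs I is = 0")
    case False
    then have m: "mset is = mset I" by (rule dxs_support)
    then have "is ! j \<in> set I" if "j < length is" for j using that by (metis mset_eq_setD nth_mem)
    moreover have "length is = card (set I)" using m I(3) by (metis distinct_card mset_eq_length)
    ultimately show ?thesis by simp
  qed (simp cong: if_cong)
  finally have B: "(\<Sum>j<length is. \<Sum>c\<in>UNIV. pd (is ! j) (\<lambda>x. special_conf x c) x * frm f I x (is[j := c])) =
    (\<Sum>c\<in>set I. f x * x $ c * N c) + f x * x $ y * (real (card (set I)) * dxs I is)" .
  have "lie (rotation b) (frm (\<lambda>x. f x * x $ b) I) x is =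
     x $ y * (if b = z then x $ z * pd z f x * dxs I is else 0) + x $ y * f x * dxs I is + f x * x $ b * N b"
    if b: "b \<in> set I" for b
  proof -
    have "b \<noteq> y" using b I by blast
    then have "pd y (\<lambda>x. f x * x $ b) = (\<lambda>x. 0)" using f zy by (simp add: pd_mult' pd_coord)
    moreover have "pd b (\<lambda>x. f x * x $ b) x = (if b = z then x $ z * pd z f x else 0) + f x"
      using f by (simp add: pd_mult' pd_coord)
    moreover have "tamef (\<lambda>x. f x * x $ b)" using f by (intro tame_intros) auto
    ultimately show ?thesis using b I(1)
      by (subst lie_rotation_frm) (auto simp: N_def algebra_simps)
  qed
  then have "(\<Sum>b\<in>set I. lie (rotation b) (frm (\<lambda>x. f x * x $ b) I) x is) =
     x $ y * (x $ z * pd z f x * dxs I is) + real (card (set I)) * (x $ y * f x * dxs I is) + (\<Sum>b\<in>set I. f x * x $ b * N b)"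
    using I(2) by (simp add: sum.distrib sum_distrib_left[symmetric])
  then show ?thesis unfolding lie_def A B by (simp add: algebra_simps)
qed

end

subsection \<open>Coordinate space as a manifold\<close>

text \<open>With a single global chart, a field is one family of component functions and the only
  transition map is the identity.\<close>

definition coord_space :: "'n::finite mfd" where
  "coord_space = \<lparr>top_of = euclidean, atlas = {(UNIV, id)}\<rparr>"

lemma atlas_coord_space [simp]: "atlas coord_space = {(UNIV, id)}"
  by (simp add: coord_space_def)

lemma transition_id [simp]: "transition (UNIV, id) (UNIV, id) x = x"
  by (simp add: transition_def)

lemma second_countable_euclidean_space: "second_countable (euclidean :: 'a::second_countable_topology topology)"
proof -
  obtain B :: "'a set set" where B: "countable B" "topological_basis B"
    using ex_countable_basis by blast
  have "\<exists>V\<in>B. x \<in> V \<and> V \<subseteq> U" if "open U" "x \<in> U" for U x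
    using that by (meson B(2) topological_basisE)
  then show ?thesis
    unfolding second_countable_def using B topological_basis_open by (intro exI[of _ B]) auto
qed

lemma smooth_manifold_coord_space: "smooth_manifold coord_space"
  using tamef_smooth_on[OF tame_coord]
  by (auto simp: smooth_manifold_def coord_space_def second_countable_euclidean_space homeomorphic_map_id)

lemma tensor_field_coord_space:
  assumes "\<And>is. tamef (\<lambda>x. T x is)"
  shows "tensor_field r coord_space (\<lambda>c. T)"
proof -
  have "(\<Sum>js | length js = r. (\<Prod>m<r. jacobian (UNIV, id) (UNIV, id) x (js ! m) (is ! m)) * T x js) = T x is"
    if "length is = r" for x "is"
  proof -
    have "(\<Prod>m<r. jacobian (UNIV, id) (UNIV, id) x (js ! m) (is ! m)) = (if js = is then 1 else 0)"
      if l: "length js = r" for js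
    proof (cases "js = is")
      case False
      then obtain m where "m < r" "js ! m \<noteq> is ! m"
        using l \<open>length is = r\<close> False by (auto simp: list_eq_iff_nth_eq)
      then have "\<exists>m\<in>{..<r}. jacobian (UNIV, id) (UNIV, id) x (js ! m) (is ! m) = 0"
        by (intro bexI[of _ m]) (auto simp: jacobian_def pd_coord)
      then show ?thesis using False by (simp add: prod_zero_iff)
    qed (simp add: jacobian_def pd_coord)
    then have "(\<Sum>js | length js = r. (\<Prod>m<r. jacobian (UNIV, id) (UNIV, id) x (js ! m) (is ! m)) * T x js) =
      (\<Sum>js | length js = r. if js = is then T x js else 0)"
      by (intro sum.cong) auto
    also have "\<dots> = T x is"
      using finite_lists_length_eq[of "UNIV :: 'a set" r] that by (subst sum.delta) auto
    finally show ?thesis .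
  qed
  then show ?thesis using tamef_smooth_on[OF assms] by (auto simp: tensor_field_def)
qed

lemma is_form_frm:
  assumes "tamef f" "length I = k"
  shows "is_form k coord_space (\<lambda>c. frm f I)"
  unfolding is_form_def
proof (intro conjI ballI)
  show "tensor_field k coord_space (\<lambda>c. frm f I)"
    by (rule tensor_field_coord_space) (rule tamef_frm[OF assms(1)])
  show "alternating k (frm f I x)" for x
    using alternating_dxs[of I] assms(2) by (auto simp: alternating_def frm_def)
qed

lemma lie_eq_0:
  assumes "\<And>x is. length is = r \<Longrightarrow> T x is = 0" "length is = r"
  shows "lie X T x is = 0"
  using assms by (simp add: lie_def)

context flat_signs
begin

section \<open>Codifferentials of natural operators on the test forms\<close>

lemma coderiv_natural_eq_0:
  assumes "\<And>x js. length js = Suc k \<Longrightarrow> F flat u x js = 0" "length is = k"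
  shows "contract flat (nabla flat (F flat u)) x is = 0"
  using assms by (simp add: contract_cmet nabla_cmet)

text \<open>The first order term is given by the special conformal field, and vanishes because natural
  operators kill the forms in question for reasons of parity.\<close>

lemma coderiv_natural_second_order:
  assumes F: "natural k 1 (Suc k) F"
    and alt: "\<And>f x. tamef f \<Longrightarrow> alternating (Suc k) (F flat (frm f I) x)"
    and h: "tamef h" "\<And>a. a \<noteq> z \<Longrightarrow> pd a h = (\<lambda>x. 0)"
    and I: "y \<notin> set I" "z \<in> set I" "distinct I" "length I = k" and l: "length is = k"
  obtains C where "tame C" "\<And>t x. coderiv (cmet t) (F (cmet t) (frm h I)) x is = t\<^sup>2 * C t x"
proof -
  define W where "W = (\<lambda>g u. contract g (nabla g (F g u)))"
  have W: "natural k 1 k W" unfolding W_def using F by (intro natural.contr natural.deriv)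
  note cX = conf_field_special_conf
  have tX: "tamef (\<lambda>x. special_conf x b)" for b using cX by (auto simp: conf_field_def)
  \<comment> \<open>The variation lemma needs arguments moving as u + t u1, whereas here u is fixed.
    The excess t W(u1) is of second order because W(u1) is itself of first order; the latter follows
    from the variation along u1 + t u2.\<close>
  define u where "u = frm h I"
  define u1 where "u1 = lie special_conf u"
  define u2 where "u2 = lie special_conf u1"
  have tu: "tamef (\<lambda>x. u x js)" for js unfolding u_def by (rule tamef_frm[OF h(1)])
  have tu1: "tamef (\<lambda>x. u1 x js)" for js unfolding u1_def by (rule tamef_lie[OF tX tu refl])
  have tu2: "tamef (\<lambda>x. u2 x js)" for js unfolding u2_def by (rule tamef_lie[OF tX tu1 refl])
  have kill: "F flat (frm f I) x js = 0"
    if "tamef f" "\<And>a. a \<notin> set I \<Longrightarrow> pd a f = (\<lambda>x. 0)" "length js = Suc k" for f x js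
    using natural_alternating_frm[OF F I(4) that(1,2) alt[OF that(1)] that(3)] .
  have "F flat u x js = 0" if "length js = Suc k" for x js
    unfolding u_def
  proof (rule kill[OF h(1) h(2) that])
    show "a \<noteq> z" if "a \<notin> set I" for a using that I(2) by blast
  qed
  then have Wu: "W flat u x js = 0" if "length js = k" for x js
    unfolding W_def using that by (rule coderiv_natural_eq_0)
  \<comment> \<open>\<open>u1\<close> is a sum of Lie derivatives along rotations of forms x_b u. F
    commutes with these derivatives and kills x_b u, whose coefficient still depends only on
    coordinates in \<open>I\<close>.\<close>
  have "F flat u1 x js = 0" if js: "length js = Suc k" for x js
  proof -
    have th: "tamef (\<lambda>x. h x * x $ b)" for b using h(1) by (intro tame_intros) auto
    have tr: "tamef (\<lambda>x. rotation b x c)" for b c unfolding rotation_def by (intro tame_intros) auto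
    have "u1 = (\<lambda>x is. \<Sum>b\<in>set I. lie (rotation b) (frm (\<lambda>x. h x * x $ b) I) x is)"
      unfolding u1_def u_def by (intro ext) (rule lie_special_conf_frm[OF h I(1,2,3)])
    then have "F flat u1 x js = (\<Sum>b\<in>set I. F flat (lie (rotation b) (frm (\<lambda>x. h x * x $ b) I)) x js)"
      using natural_sum[OF F, of "set I" "\<lambda>b. lie (rotation b) (frm (\<lambda>x. h x * x $ b) I)"]
        tamef_lie[OF tr tamef_frm[OF th] refl] by simp
    also have "\<dots> = 0"
    proof (rule sum.neutral, intro ballI)
      fix b assume b: "b \<in> set I"
      then have "b \<noteq> y" using I by blast
      have zero: "F flat (frm (\<lambda>x. h x * x $ b) I) x js = 0" if "length js = Suc k" for x js
      proof (rule kill[OF th _ that])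
        fix a assume "a \<notin> set I"
        then have "a \<noteq> b" "a \<noteq> z" using b I by auto
        then show "pd a (\<lambda>x. h x * x $ b) = (\<lambda>x. 0)"
          by (simp add: pd_mult' h pd_coord)
      qed
      have "lie (rotation b) (F flat (frm (\<lambda>x. h x * x $ b) I)) x js = 0"
        by (rule lie_eq_0[OF zero js])
      then show "F flat (lie (rotation b) (frm (\<lambda>x. h x * x $ b) I)) x js = 0"
        using natural_lie_commute[OF F conf_field_rotation[OF \<open>b \<noteq> y\<close>] tamef_frm[OF th] js] by simp
    qed
    finally show ?thesis .
  qed
  then have Wu1: "W flat u1 x js = 0" if "length js = k" for x js
    unfolding W_def using that by (rule coderiv_natural_eq_0)
  have "expands (\<lambda>t x. u x js + t * u1 x js) (\<lambda>x. u x js) (\<lambda>x. lie special_conf u x js)" for js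
    unfolding u1_def[symmetric] by (rule expandsI[of _ _ "\<lambda>t x. 0"]) (auto simp: tu tu1)
  from natural_variation[OF W cX this l]
  obtain C1 where C1: "tame C1" "\<And>t x. W (cmet t) u x is + t * W (cmet t) u1 x is = t\<^sup>2 * C1 t x"
    unfolding expands_def using lie_eq_0[of k "W flat u"] Wu l
    by (auto simp: natural_add_scaled[OF W tu tu1])
  have "expands (\<lambda>t x. u1 x js + t * u2 x js) (\<lambda>x. u1 x js) (\<lambda>x. lie special_conf u1 x js)" for js
    unfolding u2_def[symmetric] by (rule expandsI[of _ _ "\<lambda>t x. 0"]) (auto simp: tu1 tu2)
  from natural_variation[OF W cX this l]
  obtain C2 where C2: "tame C2" "\<And>t x. W (cmet t) u1 x is + t * W (cmet t) u2 x is = t\<^sup>2 * C2 t x"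
    unfolding expands_def using lie_eq_0[of k "W flat u1"] Wu1 l
    by (auto simp: natural_add_scaled[OF W tu1 tu2])
  have D: "tame (\<lambda>t x. W (cmet t) u2 x is)"
    using natural_tame[OF W, of "\<lambda>_. u2" 1] tu2 by simp
  have "coderiv (cmet t) (F (cmet t) (frm h I)) x is = t\<^sup>2 * - (C1 t x - t * C2 t x + W (cmet t) u2 x is)" for t x
  proof -
    have 1: "W (cmet t) u1 x is = t\<^sup>2 * C2 t x - t * W (cmet t) u2 x is" using C2(2)[of t x] by simp
    have "W (cmet t) u x is = t\<^sup>2 * C1 t x - t * W (cmet t) u1 x is" using C1(2)[of t x] by simp
    then show ?thesis unfolding 1
      by (simp add: coderiv_def W_def u_def power2_eq_square algebra_simps)
  qed
  moreover have "tame (\<lambda>t x. - (C1 t x - t * C2 t x + W (cmet t) u2 x is))"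
    using C1(1) C2(1) D by (intro tame_intros) auto
  ultimately show thesis using that by blast
qed

text \<open>In the flat metric F commutes with partial derivatives, and only the z-derivative of the
  argument is nonzero. The divergence thus reduces to one component of F applied to the next lower
  power.\<close>

lemma coderiv_natural_zpow:
  assumes F: "natural k 1 (Suc r) F" and l: "length is = r"
  shows "coderiv flat (F flat (frm (zpow z (Suc p)) I)) x is = - eps z * F flat (frm (zpow z p) I) x (z # is)"
proof -
  have t: "tamef (\<lambda>x. frm (zpow z (Suc p)) I x is)" for "is" by (rule tamef_frm) simp
  have "pd a (\<lambda>x. F flat (frm (zpow z (Suc p)) I) x (a # is)) x =
      (if a = z then F flat (frm (zpow z p) I) x (z # is) else 0)" for a
  proof -
    have "pd a (\<lambda>x. F flat (frm (zpow z (Suc p)) I) x (a # is)) x =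
      F flat (\<lambda>x js. pd a (\<lambda>x. frm (zpow z (Suc p)) I x js) x) x (a # is)"
      by (rule natural_pd_commute[OF F t, symmetric]) (simp add: l)
    also have "(\<lambda>x js. pd a (\<lambda>x. frm (zpow z (Suc p)) I x js) x) =
      (if a = z then frm (zpow z p) I else (\<lambda>x js. 0))"
      by (auto simp: fun_eq_iff pd_frm pd_zpow) (simp_all add: frm_def)
    finally show ?thesis by (simp add: natural_zero[OF F])
  qed
  then show ?thesis
    by (simp add: coderiv_def contract_cmet nabla_cmet if_distrib[of "\<lambda>v. _ * v"] cong: if_cong)
qed

subsection \<open>Densities\<close>

lemma abs_det_gmat_cmet: "\<bar>det (gmat (cmet s) x)\<bar> = exp (2 * s * x $ y) ^ CARD('n)"
proof -
  have "det (gmat (cmet s) x) = (\<Prod>i\<in>UNIV. gmat (cmet s) x $ i $ i)"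
    by (rule det_diagonal) (simp add: gmat_def cmet_pair)
  moreover have "\<bar>eps i\<bar> = 1" for i
    using eps_sq[of i] by (metis abs_mult_self_eq abs_1 abs_square_eq_1 power2_eq_square)
  ultimately show ?thesis by (simp add: gmat_def cmet_pair abs_prod abs_mult prod.distrib)
qed

text \<open>Where s y = 0 the scale has determinant of absolute value 1, so density factors are
  invisible. This is why values are compared at the origin.\<close>

lemma dens_cmet_0: "s * x $ y = 0 \<Longrightarrow> dens w (cmet s) T x is = T x is"
  by (auto simp: dens_def abs_det_gmat_cmet)

lemma undens_dens_cmet: "dens (- w) (cmet s) (dens w (cmet s) T) = T"
  by (auto simp: fun_eq_iff dens_def abs_det_gmat_cmet simp flip: powr_add mult.assoc)

text \<open>The inner density factors cancel as fields, before differentiation; only the outer one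
  has to be evaluated at the point.\<close>

lemma codiff_cmet_0:
  assumes "s * x $ y = 0"
  shows "codiff k (cmet s) (dens_E (Suc k) (cmet s) T) x is = coderiv (cmet s) T x is"
proof -
  have "undens_E (Suc k) (cmet s) (dens_E (Suc k) (cmet s) T) = T"
    unfolding undens_E_def dens_E_def by (rule undens_dens_cmet)
  then show ?thesis using assms by (simp only: codiff_def) (simp only: dens_E_def dens_cmet_0)
qed

lemma rescale_flat: "rescale (\<lambda>c x is. t * x $ y) (\<lambda>c. flat) = (\<lambda>c. cmet t)"
  by (simp add: rescale_def fun_eq_iff cmet_def mult.assoc)

lemma is_metric_cmet:
  assumes "card {i. eps i = -1} = q"
  shows "is_metric q coord_space (\<lambda>c. cmet s)"
  unfolding is_metric_def
proof (intro conjI ballI)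
  show "tensor_field 2 coord_space (\<lambda>c. cmet s)"
    by (rule tensor_field_coord_space) (use tame_const_fam[OF tame_cmet[of s], of 1] in simp)
  fix c x
  have pm: "eps i = 1 \<or> eps i = -1" for i
    using eps_sq[of i] by (metis power2_eq_1_iff power2_eq_square)
  define E where "E = exp (s * x $ y)"
  \<comment> \<open>Rescaling the coordinate frame by e^(-s y) brings the metric to its signs
    \<open>eps\<close>.\<close>
  let ?P = "\<chi> i j. if i = j then inverse E else 0 :: real^'n^'n"
  have E: "E \<noteq> 0" "exp (2 * s * x $ y) = E * E" by (auto simp: E_def simp flip: exp_add)
  have EE: "inverse E * (E * E * e) * inverse E = e" "inverse E * (E * E) * inverse E = 1" for e
    using E(1) by (simp_all add: field_simps)
  have "?P ** (\<chi> i j. if i = j then E else 0) = mat 1"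
    using E(1) by (auto simp: vec_eq_iff matrix_matrix_mult_def mat_def
      if_distrib[of "\<lambda>z. _ * z"] if_distrib[of "\<lambda>z. z * _"] cong: if_cong)
  then have "invertible ?P" using invertible_right_inverse by blast
  moreover have "Finite_Cartesian_Product.transpose ?P ** gmat (cmet s) x ** ?P =
      (\<chi> i j. if i = j then (if i \<in> {i. eps i = -1} then -1 else 1) else 0)"
    using E(2) pm by (auto simp: EE vec_eq_iff matrix_matrix_mult_def gmat_def cmet_pair
      Finite_Cartesian_Product.transpose_def if_distrib[of "\<lambda>z. _ * z"] if_distrib[of "\<lambda>z. z * _"] cong: if_cong)
  ultimately show "has_signature q (gmat (cmet s) x)"
    unfolding has_signature_def using assms by blast
qed

end

theorem theorem3p2:
  fixes Q :: "nat \<Rightarrow> 'n::finite oper" and q k :: nat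
  assumes n_even: "even CARD('n)"
    and signature: "q \<le> CARD('n)"
    and Q_natural: "\<And>j. j \<le> CARD('n) div 2 + 1 \<Longrightarrow> natural_op q j j (Q j)"
    and Q_self_adjoint: "\<And>j. j \<le> CARD('n) div 2 + 1 \<Longrightarrow> self_adjoint q j (Q j)"
    and Q_middle: "\<exists>a. a \<noteq> 0 \<and>
      op_eq q (CARD('n) div 2) (CARD('n) div 2) (Q (CARD('n) div 2)) (\<lambda>g u x is. a * u x is)"
    and Q_last: "op_eq q (CARD('n) div 2 + 1) (CARD('n) div 2 + 1) (Q (CARD('n) div 2 + 1))
      (\<lambda>g u x is. 0)"
    and Q_leading: "\<And>j. j \<le> CARD('n) div 2 \<Longrightarrow> \<exists>a. a \<noteq> 0 \<and>
      order_less q j j (CARD('n) - 2 * j) (\<lambda>g u x is. Q j g u x is -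
        a * dens_E j g (((\<lambda>v. ext_d (coderiv g v)) ^^ (CARD('n) div 2 - j)) u) x is)"
    and Q_transform: "\<And>j (M :: 'n mfd) g \<omega> u. j \<le> CARD('n) div 2 \<Longrightarrow>
      smooth_manifold M \<Longrightarrow> is_metric q M g \<Longrightarrow> is_form 0 M \<omega> \<Longrightarrow> closed_form j M u \<Longrightarrow>
      agree j M (apply_op (Q j) (rescale \<omega> g) u)
        (\<lambda>c x is. apply_op (Q j) g u c x is +
          apply_op (\<lambda>g v. codiff j g (Q (j + 1) g (ext_d v))) g (fmult \<omega> u) c x is)"
    and Q_conf_inv: "\<And>j. j \<le> CARD('n) div 2 \<Longrightarrow>
      conf_inv q j j (\<lambda>g u. codiff j g (Q (j + 1) g (ext_d u)))"
    and k_range: "1 \<le> k" "k \<le> CARD('n) div 2 - 1"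
  shows "\<not> (\<exists>L U. natural_op q k k L \<and> conf_inv_closed q k k L \<and> natural_op q k (k + 1) U \<and>
      op_eq q k k (Q k) (\<lambda>g u x is. L g u x is + codiff k g (U g u) x is))"
proof
  let ?n = "CARD('n)"
  assume "\<exists>L U. natural_op q k k L \<and> conf_inv_closed q k k L \<and> natural_op q k (k + 1) U \<and>
      op_eq q k k (Q k) (\<lambda>g u x is. L g u x is + codiff k g (U g u) x is)"
  then obtain L U where L: "conf_inv_closed q k k L" and U: "natural_op q k (k + 1) U"
    and QLU: "op_eq q k k (Q k) (\<lambda>g u x is. L g u x is + codiff k g (U g u) x is)" by blast

  \<comment> \<open>Choice of signature, coordinates and test form\<close>
  have k: "k + 1 \<le> ?n div 2" using k_range by linarith
  obtain S :: "'n set" where S: "card S = q"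
    using obtain_subset_with_card_n[OF signature] by blast
  define eps where "eps i = (if i \<in> S then -1 else 1 :: real)" for i
  obtain xs :: "'n list" where xs: "set xs = UNIV" "distinct xs" using finite_distinct_list[OF finite[of "UNIV :: 'n set"]] by blast
  have "length xs = ?n" using xs by (metis distinct_card)
  \<comment> \<open>There are at least k + 1 coordinates. The list J = (y, z, theta) starts with the
    conformal direction, and I = (z, theta) carries the test form; z exists because k is at least
    1.\<close>
  define J where "J = take (Suc k) xs"
  have J: "length J = Suc k" "distinct J" using \<open>length xs = ?n\<close> k xs by (auto simp: J_def)
  obtain y I where yI: "J = y # I" "length I = k" using J(1) by (cases J) auto
  obtain z \<theta> where I: "I = z # \<theta>" using yI(2) k_range(1) by (cases I) auto
  have dist: "y \<notin> set I" "distinct I" "y \<noteq> z" "y \<notin> set \<theta>" using J(2) yI I by auto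
  interpret flat_signs eps y by unfold_locales (simp add: eps_def)
  have q: "card {i. eps i = -1} = q" using S by (simp add: eps_def)
  have M: "smooth_manifold (coord_space :: 'n mfd)" by (rule smooth_manifold_coord_space)
  note met = is_metric_cmet[OF q]
  obtain a where a: "a \<noteq> 0" and lead: "order_less q (k + 1) (k + 1) (?n - 2 * (k + 1)) (\<lambda>g u x is. Q (k + 1) g u x is -
      a * dens_E (k + 1) g (((\<lambda>v. ext_d (coderiv g v)) ^^ (?n div 2 - (k + 1))) u) x is)"
    using Q_leading[OF k] by blast
  define m where "m = ?n div 2 - (k + 1)"
  \<comment> \<open>N = n - 2k - 2 is the order of the leading term of \<open>Q (k + 1)\<close>,
    which consists of m factors d delta.\<close>
  define N where "N = 2 * m"
  have N: "?n - 2 * (k + 1) = N" using n_even by (auto simp: N_def m_def)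
  obtain FU where FU: "natural k 1 (Suc k) FU" "U = (\<lambda>g u. dens_E (Suc k) g (FU g u))"
    and alt: "\<And>(M :: 'n mfd) g u c x. smooth_manifold M \<Longrightarrow> is_metric q M g \<Longrightarrow> is_form k M u \<Longrightarrow>
        c \<in> atlas M \<Longrightarrow> x \<in> coords c \<Longrightarrow> alternating (Suc k) (FU (g c) (u c) x)"
    using U unfolding natural_op_def Suc_eq_plus1[symmetric] by blast
  obtain FQ where FQ: "natural (Suc k) 1 (Suc k) FQ" "Q (Suc k) = (\<lambda>g u. dens_E (Suc k) g (FQ g u))"
    using Q_natural[of "Suc k"] k unfolding natural_op_def by auto
  have altU: "alternating (Suc k) (FU flat (frm f I) x)" if "tamef f" for f x
    using alt[OF M met is_form_frm[OF that yI(2)], of "(UNIV, id)" x] by simp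
  \<comment> \<open>The exponent is N + 1: the outer codifferential uses one power and the leading
    term the remaining N.\<close>
  define h where "h = zpow z (Suc N)"
  have h: "tamef h" "\<And>a. a \<noteq> z \<Longrightarrow> pd a h = (\<lambda>x. 0)" by (auto simp: h_def pd_zpow)
  \<comment> \<open>Contracting dx_J with the z-direction leaves this component.\<close>
  define js where "js = y # \<theta>"
  have js: "length js = k" using yI(2) I by (simp add: js_def)
  have form: "is_form k coord_space (\<lambda>c. frm h I)" by (rule is_form_frm[OF h(1) yI(2)])
  have closed: "closed_form k coord_space (\<lambda>c. frm h I)"
    using form h I by (auto simp: closed_form_def intro!: ext_d_frm_closed)

  \<comment> \<open>The conformal change at the origin\<close>
  define D where "D = coderiv flat (FQ flat (frm h J)) 0 js"
  have tFQ: "tamef (\<lambda>x. FQ flat (frm h J) x is)" for "is"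
    using natural_tamef[OF FQ(1)] tamef_frm[OF h(1)] by blast
  \<comment> \<open>At the origin y = 0, so no density factors appear. L does not change on the
    closed test form, so the codifferential of U absorbs the whole change of
    \<open>Q k\<close>.\<close>
  have D_eq: "t * D = coderiv (cmet t) (FU (cmet t) (frm h I)) 0 js - coderiv flat (FU flat (frm h I)) 0 js" for t
  proof -
    have w: "is_form 0 coord_space (\<lambda>c x is. t * x $ y)"
      unfolding is_form_def
      by (intro conjI tensor_field_coord_space ballI) (auto intro!: tame_intros simp: alternating_def)
    have split: "Q k (cmet s) (frm h I) 0 js = L (cmet s) (frm h I) 0 js + coderiv (cmet s) (FU (cmet s) (frm h I)) 0 js" for s
      using QLU[unfolded op_eq_def, rule_format, of coord_space "\<lambda>c. cmet s" "\<lambda>c. frm h I"] M met form js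
      by (simp add: agree_def apply_op_def FU(2) codiff_cmet_0)
    have "L (cmet t) (frm h I) 0 js = L flat (frm h I) 0 js"
      using L[unfolded conf_inv_closed_def, rule_format, of coord_space "\<lambda>c. flat" "\<lambda>c x is. t * x $ y" "\<lambda>c. frm h I"]
        M met w closed js by (simp add: agree_def apply_op_def rescale_flat)
    moreover have "Q k (cmet t) (frm h I) 0 js = Q k flat (frm h I) 0 js + t * D"
    proof -
      \<comment> \<open>dh is a multiple of dz, which already occurs in dx_I; only dy survives, and
        dy wedge dx_I is dx_J.\<close>
      have "ext_d (\<lambda>x is. t * x $ y * frm h I x is) = (\<lambda>x is. t * frm h J x is)"
      proof (intro ext)
        fix x "is"
        have th: "tamef (\<lambda>x. t * x $ y * h x)" using h(1) by (intro tame_intros) auto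
        have "(\<lambda>x is. t * x $ y * frm h I x is) = frm (\<lambda>x. t * x $ y * h x) I"
          by (simp add: frm_def fun_eq_iff mult.assoc)
        then have "ext_d (\<lambda>x is. t * x $ y * frm h I x is) x is =
          (\<Sum>b\<in>UNIV. pd b (\<lambda>x. t * x $ y * h x) x * wedge b (dxs I) is)"
          using ext_d_frm[OF th] by simp
        also have "\<dots> = (\<Sum>b\<in>UNIV. if b = y then t * h x * wedge y (dxs I) is else 0)"
        proof (rule sum.cong)
          fix b :: 'n
          have p: "pd b (\<lambda>x. t * x $ y * h x) x = t * (if b = y then 1 else 0) * h x + t * x $ y * pd b h x"
            using h(1) by (simp add: pd_mult' tame_mult pd_cmult pd_coord)
          show "pd b (\<lambda>x. t * x $ y * h x) x * wedge b (dxs I) is = (if b = y then t * h x * wedge y (dxs I) is else 0)"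
          proof (cases "b = z")
            case True
            then show ?thesis using wedge_dxs_same[of z I] I dist by simp
          next
            case False
            then show ?thesis unfolding p by (simp add: h(2))
          qed
        qed simp
        finally show "ext_d (\<lambda>x is. t * x $ y * frm h I x is) x is = t * frm h J x is"
          by (simp add: frm_def yI)
      qed
      moreover have "FQ flat (\<lambda>x is. t * frm h J x is) = (\<lambda>x is. t * FQ flat (frm h J) x is)"
        by (intro ext natural_scale[OF FQ(1)] tamef_frm h(1))
      moreover have "coderiv flat (\<lambda>x is. t * FQ flat (frm h J) x is) 0 js = t * D"
        by (simp add: D_def coderiv_def contract_cmet nabla_cmet pd_cmult[OF tFQ] sum_distrib_left mult_ac)
      ultimately show ?thesis
        using Q_transform[of k coord_space "\<lambda>c. flat" "\<lambda>c x is. t * x $ y" "\<lambda>c. frm h I"] M met w closed js k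
        by (simp add: agree_def apply_op_def rescale_flat fmult_def FQ(2) codiff_cmet_0)
    qed
    ultimately show ?thesis using split[of t] split[of 0] by linarith
  qed

  \<comment> \<open>Vanishing of the first order term\<close>
  obtain C where C: "tame C" "\<And>t x. coderiv (cmet t) (FU (cmet t) (frm h I)) x js = t\<^sup>2 * C t x"
    using coderiv_natural_second_order[OF FU(1) altU h dist(1) _ dist(2) yI(2) js] I by auto
  obtain K where K: "\<And>t. \<bar>t\<bar> \<le> 1 \<Longrightarrow> \<bar>C t 0\<bar> \<le> K" using tame_bounded[OF C(1)] by blast
  have "D = 0"
  proof (rule eq_0_if_bounded_by_multiples)
    fix t :: real assume t: "0 < t" "t \<le> 1"
    \<comment> \<open>The expansion at t = 0 shows that the flat codifferential term vanishes, so
      \<open>D_eq\<close> leaves only a second order quantity.\<close>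
    have "t * D = t\<^sup>2 * C t 0" using D_eq[of t] C(2)[of t 0] C(2)[of 0 0] by simp
    then have "D = t * C t 0" using t by (simp add: power2_eq_square)
    then show "\<bar>D\<bar> \<le> t * K" using K[of t] t by (simp add: abs_mult mult_left_mono)
  qed

  \<comment> \<open>Evaluation through the leading term\<close>
  have "D = - eps z * FQ flat (frm (zpow z N) J) 0 (z # js)"
    unfolding D_def h_def by (rule coderiv_natural_zpow[OF FQ(1) js])
  moreover have "FQ flat (frm (zpow z N) J) 0 (z # js) = a * ((- eps z) ^ m * dxs J (z # js))"
  proof -
    have f: "is_form (Suc k) coord_space (\<lambda>c. frm (zpow z N) J)" by (rule is_form_frm) (simp_all add: J)
    \<comment> \<open>All derivatives of order below N vanish at the origin, so there the lower
      order terms of \<open>Q (k + 1)\<close> contribute nothing.\<close>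
    have "foldr pd as (\<lambda>x. frm (zpow z N) J x is) 0 = 0" if "length as < N" for as "is"
      using foldr_pd_frm[of "zpow z N" as J "is"] foldr_pd_zpow[OF that] by (simp add: frm_def)
    then have "Q (Suc k) flat (frm (zpow z N) J) 0 (z # js) -
      a * dens_E (Suc k) flat (((\<lambda>v. ext_d (coderiv flat v)) ^^ m) (frm (zpow z N) J)) 0 (z # js) = 0"
      using lead[unfolded order_less_def N m_def[symmetric], rule_format, of coord_space "\<lambda>c. flat" "\<lambda>c. frm (zpow z N) J"
          "(UNIV, id)" 0 "z # js"] M met f js by simp
    \<comment> \<open>The m factors d delta use up all N powers of z and leave a constant multiple
      of dx_J.\<close>
    moreover have "((\<lambda>v. ext_d (coderiv flat v)) ^^ m) (frm (zpow z N) J) = frm (\<lambda>x. (- eps z) ^ m * zpow z 0 x) J"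
      using funpow_ext_d_coderiv_frm[of z J m 1 0] yI I by (simp add: N_def)
    ultimately show ?thesis
      by (simp add: FQ(2) dens_E_def dens_cmet_0 frm_def zpow_def)
  qed
  \<comment> \<open>The list (z, y, theta) differs from J = (y, z, theta) by one
    transposition.\<close>
  moreover have "dxs J (z # js) = -1"
  proof -
    have "\<theta> ! j \<noteq> y" if "j < length \<theta>" for j using dist(4) that nth_mem by blast
    then have "dxs J (z # js) = - dxs (z # \<theta>) (z # \<theta>)"
      using dist(3) by (simp add: yI I js_def wedge_def[of y] sum.lessThan_Suc_shift del: sum.lessThan_Suc)
    then show ?thesis using dxs_self[of "z # \<theta>"] dist(2) I by simp
  qed
  moreover have "eps z \<noteq> 0" by (simp add: eps_def)
  ultimately show False using a \<open>D = 0\<close> by simp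
qed

end
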